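(* Let $(L,[\cdot,\cdot],\alpha)$ be a Hom-Lie algebra over a field $k$, let $u$ be an $\alpha$-invariant element of $Z(L)$ (i.e. $u\in Z(L)$ and $\alpha(u)=u$), and let $\lambda\in k$. Then the linear map $$B: L\otimes L\to L\otimes L,\qquad x\otimes y\mapsto \lambda\,[x,y]\otimes u-\alpha(y)\otimes\alpha(x)$$ is a solution of the Hom-Yang-Baxter equation (with respect to the twist map $\alpha$ on $L$). If, in addition, $\alpha$ is involutive (i.e. $\alpha\circ\alpha=\mathrm{id}_L$), then $B$ is also invertible, with inverse given by $$B^{-1}: L\otimes L\to L\otimes L,\qquad x\otimes y\mapsto \lambda\, u\otimes[x,y]-\alpha(y)\otimes\alpha(x).$$ Furthermore, $B^{-1}$ is then also a solution of the Hom-Yang-Baxter equation.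
   Context: Throughout, $k$ is a fixed field; vector spaces, linear maps and tensor products are over $k$. A Hom-Lie algebra is a triple $(L,[\cdot,\cdot],\alpha)$ consisting of a $k$-linear space $L$, a bilinear map $[\cdot,\cdot]:L\otimes L\to L$ and an endomorphism $\alpha:L\to L$ (linear, with $\alpha([l,l'])=[\alpha(l),\alpha(l')]$), such that for all $l,l',l''\in L$: $[l,l']=-[l',l]$ and $[\alpha(l),[l',l'']]+[\alpha(l'),[l'',l]]+[\alpha(l''),[l,l']]=0$. Its center is $Z(L)=\{u\in L\mid [u,x]=0\ \ \forall x\in L\}$. Hom-Yang-Baxter equation (HYBE): given a vector space $V$ and a linear endomorphism $\alpha$ of $V$, a linear map $B:V\otimes V\to V\otimes V$ is a solution of the HYBE if $B$ commutes with $\alpha\otimes\alpha$, i.e. $(\alpha\otimes\alpha)\circ B=B\circ(\alpha\otimes\alpha)$, and $$(\alpha\otimes B)\circ(B\otimes\alpha)\circ(\alpha\otimes B)=(B\otimes\alpha)\circ(\alpha\otimes B)\circ(B\otimes\alpha)$$ as maps $V\otimes V\otimes V\to V\otimes V\otimes V$. *)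

theory Defs
  imports "Jordan_Normal_Form.Missing_VectorSpace" "HOL-Algebra.QuotRing"
begin

text \<open>
  Vector spaces and linear maps are the carrier-based \<^locale>\<open>vectorspace\<close> and
  \<^locale>\<open>linear_map\<close>. The values of a map outside the carrier of its domain are
  irrelevant, so maps are always compared pointwise on carriers.
\<close>

definition bilinear_map ::
  "('k, 'kx) ring_scheme \<Rightarrow> ('k, 'v, 'vx) module_scheme \<Rightarrow> ('k, 'w, 'wx) module_scheme \<Rightarrow>
   ('k, 'p, 'px) module_scheme \<Rightarrow> ('v \<Rightarrow> 'w \<Rightarrow> 'p) \<Rightarrow> bool" where
  "bilinear_map K V W P b \<longleftrightarrow>
     (\<forall>v\<in>carrier V. linear_map K W P (b v)) \<and>
     (\<forall>w\<in>carrier W. linear_map K V P (\<lambda>v. b v w))"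

subsection \<open>Tensor products\<close>

text \<open>
  The tensor product of \<open>V\<close> and \<open>W\<close> is the vector space freely generated by
  \<open>carrier V \<times> carrier W\<close>, modulo the subspace spanned by the bilinearity relations.
\<close>

definition free_space ::
  "('k, 'kx) ring_scheme \<Rightarrow> 's set \<Rightarrow> ('k, 's \<Rightarrow> 'k) module" where
  "free_space K S = (ring.func_space K S)
     \<lparr>carrier := {f \<in> S \<rightarrow>\<^sub>E carrier K. finite {s \<in> S. f s \<noteq> \<zero>\<^bsub>K\<^esub>}}\<rparr>"

definition free_gen :: "('k, 'kx) ring_scheme \<Rightarrow> 's set \<Rightarrow> 's \<Rightarrow> 's \<Rightarrow> 'k" where
  "free_gen K S s = (\<lambda>t\<in>S. if t = s then \<one>\<^bsub>K\<^esub> else \<zero>\<^bsub>K\<^esub>)"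

definition linear_extension ::
  "('k, 'kx) ring_scheme \<Rightarrow> 's set \<Rightarrow> ('k, 'p, 'px) module_scheme \<Rightarrow> ('s \<Rightarrow> 'p) \<Rightarrow>
   ('s \<Rightarrow> 'k) \<Rightarrow> 'p" where
  "linear_extension K S P b f =
     (\<Oplus>\<^bsub>P\<^esub> s \<in> {s \<in> S. f s \<noteq> \<zero>\<^bsub>K\<^esub>}. f s \<odot>\<^bsub>P\<^esub> b s)"

text \<open>
  As in \<^const>\<open>FactRing\<close>, vectors of the quotient are additive cosets. The
  multiplicative fields of the record play no role in a module.
\<close>

definition quotient_space ::
  "('k, 'v, 'vx) module_scheme \<Rightarrow> 'v set \<Rightarrow> ('k, 'v set) module" where
  "quotient_space V N =
     \<lparr>carrier = a_rcosets\<^bsub>V\<^esub> N, mult = (\<lambda>A B. N), one = N, zero = N,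
      add = set_add V, smult = (\<lambda>c A. \<Union>v\<in>A. N +>\<^bsub>V\<^esub> (c \<odot>\<^bsub>V\<^esub> v))\<rparr>"

definition tensor_relations ::
  "('k, 'kx) ring_scheme \<Rightarrow> ('k, 'v, 'vx) module_scheme \<Rightarrow> ('k, 'w, 'wx) module_scheme \<Rightarrow>
   ('v \<times> 'w \<Rightarrow> 'k) set" where
  "tensor_relations K V W =
     (let F = free_space K (carrier V \<times> carrier W);
          g = free_gen K (carrier V \<times> carrier W)
      in {g (v \<oplus>\<^bsub>V\<^esub> v', w) \<ominus>\<^bsub>F\<^esub> (g (v, w) \<oplus>\<^bsub>F\<^esub> g (v', w)) | v v' w.
            v \<in> carrier V \<and> v' \<in> carrier V \<and> w \<in> carrier W} \<union>
         {g (v, w \<oplus>\<^bsub>W\<^esub> w') \<ominus>\<^bsub>F\<^esub> (g (v, w) \<oplus>\<^bsub>F\<^esub> g (v, w')) | v w w'.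
            v \<in> carrier V \<and> w \<in> carrier W \<and> w' \<in> carrier W} \<union>
         {g (c \<odot>\<^bsub>V\<^esub> v, w) \<ominus>\<^bsub>F\<^esub> (c \<odot>\<^bsub>F\<^esub> g (v, w)) | c v w.
            c \<in> carrier K \<and> v \<in> carrier V \<and> w \<in> carrier W} \<union>
         {g (v, c \<odot>\<^bsub>W\<^esub> w) \<ominus>\<^bsub>F\<^esub> (c \<odot>\<^bsub>F\<^esub> g (v, w)) | c v w.
            c \<in> carrier K \<and> v \<in> carrier V \<and> w \<in> carrier W})"

definition tensor_null ::
  "('k, 'kx) ring_scheme \<Rightarrow> ('k, 'v, 'vx) module_scheme \<Rightarrow> ('k, 'w, 'wx) module_scheme \<Rightarrow>
   ('v \<times> 'w \<Rightarrow> 'k) set" where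
  "tensor_null K V W =
     module.span K (free_space K (carrier V \<times> carrier W)) (tensor_relations K V W)"

definition tensor_space ::
  "('k, 'kx) ring_scheme \<Rightarrow> ('k, 'v, 'vx) module_scheme \<Rightarrow> ('k, 'w, 'wx) module_scheme \<Rightarrow>
   ('k, ('v \<times> 'w \<Rightarrow> 'k) set) module" where
  "tensor_space K V W =
     quotient_space (free_space K (carrier V \<times> carrier W)) (tensor_null K V W)"

definition tensor_elem ::
  "('k, 'kx) ring_scheme \<Rightarrow> ('k, 'v, 'vx) module_scheme \<Rightarrow> ('k, 'w, 'wx) module_scheme \<Rightarrow>
   'v \<Rightarrow> 'w \<Rightarrow> ('v \<times> 'w \<Rightarrow> 'k) set" where
  "tensor_elem K V W v w =
     tensor_null K V W +>\<^bsub>free_space K (carrier V \<times> carrier W)\<^esub>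
       free_gen K (carrier V \<times> carrier W) (v, w)"

text \<open>
  The linear map from the tensor product of \<open>V\<close> and \<open>W\<close> to \<open>P\<close> that sends
  \<open>tensor_elem K V W v w\<close> to \<open>b v w\<close>, for bilinear \<open>b\<close>: the linear extension of \<open>b\<close> is
  constant on each coset, and \<^const>\<open>the_elem\<close> picks its value. See
  \<open>tensor_lift_linear\<close>, \<open>tensor_lift_elem\<close> and \<open>tensor_space_unique\<close> below.
\<close>

definition tensor_lift ::
  "('k, 'kx) ring_scheme \<Rightarrow> ('k, 'v, 'vx) module_scheme \<Rightarrow> ('k, 'w, 'wx) module_scheme \<Rightarrow>
   ('k, 'p, 'px) module_scheme \<Rightarrow> ('v \<Rightarrow> 'w \<Rightarrow> 'p) \<Rightarrow> ('v \<times> 'w \<Rightarrow> 'k) set \<Rightarrow> 'p" where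
  "tensor_lift K V W P b X =
     the_elem (linear_extension K (carrier V \<times> carrier W) P (\<lambda>(v, w). b v w) ` X)"

subsubsection \<open>The universal property\<close>

lemma vectorspaceI: "field K \<Longrightarrow> module K V \<Longrightarrow> vectorspace K V"
  by (simp add: vectorspace_def)

lemma free_space_simps:
  assumes "field K"
  shows "carrier (free_space K S) = {f \<in> S \<rightarrow>\<^sub>E carrier K. finite {s \<in> S. f s \<noteq> \<zero>\<^bsub>K\<^esub>}}"
    and "f \<oplus>\<^bsub>free_space K S\<^esub> g = (\<lambda>s\<in>S. f s \<oplus>\<^bsub>K\<^esub> g s)"
    and "c \<odot>\<^bsub>free_space K S\<^esub> f = (\<lambda>s\<in>S. c \<otimes>\<^bsub>K\<^esub> f s)"
    and "\<zero>\<^bsub>free_space K S\<^esub> = (\<lambda>s\<in>S. \<zero>\<^bsub>K\<^esub>)"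
proof -
  interpret field K by fact
  show "carrier (free_space K S) = {f \<in> S \<rightarrow>\<^sub>E carrier K. finite {s \<in> S. f s \<noteq> \<zero>\<^bsub>K\<^esub>}}"
    and "f \<oplus>\<^bsub>free_space K S\<^esub> g = (\<lambda>s\<in>S. f s \<oplus>\<^bsub>K\<^esub> g s)"
    and "c \<odot>\<^bsub>free_space K S\<^esub> f = (\<lambda>s\<in>S. c \<otimes>\<^bsub>K\<^esub> f s)"
    and "\<zero>\<^bsub>free_space K S\<^esub> = (\<lambda>s\<in>S. \<zero>\<^bsub>K\<^esub>)"
    by (simp_all add: free_space_def func_space_def)
qed

lemma vectorspace_free_space:
  assumes "field K"
  shows "vectorspace K (free_space K S)"
proof -
  interpret field K by fact
  interpret F: module K "func_space S" by (rule func_space_is_module)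
  have "submodule K {f \<in> S \<rightarrow>\<^sub>E carrier K. finite {s \<in> S. f s \<noteq> \<zero>\<^bsub>K\<^esub>}} (func_space S)"
  proof (unfold_locales, goal_cases)
    case 1 then show ?case by (auto simp: func_space_def)
  next
    case (2 f g)
    then have "finite ({s \<in> S. f s \<noteq> \<zero>\<^bsub>K\<^esub>} \<union> {s \<in> S. g s \<noteq> \<zero>\<^bsub>K\<^esub>})" by simp
    moreover have "{s \<in> S. (\<lambda>v\<in>S. f v \<oplus>\<^bsub>K\<^esub> g v) s \<noteq> \<zero>\<^bsub>K\<^esub>}
        \<subseteq> {s \<in> S. f s \<noteq> \<zero>\<^bsub>K\<^esub>} \<union> {s \<in> S. g s \<noteq> \<zero>\<^bsub>K\<^esub>}"
      by auto
    ultimately have "finite {s \<in> S. (\<lambda>v\<in>S. f v \<oplus>\<^bsub>K\<^esub> g v) s \<noteq> \<zero>\<^bsub>K\<^esub>}"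
      by (rule finite_subset[rotated])
    with 2 show ?case by (auto simp: func_space_def PiE_mem)
  next
    case 3 then show ?case by (auto simp: func_space_def)
  next
    case (4 c f)
    then have "finite {s \<in> S. f s \<noteq> \<zero>\<^bsub>K\<^esub>}" by simp
    moreover have "{s \<in> S. (\<lambda>v\<in>S. c \<otimes>\<^bsub>K\<^esub> f v) s \<noteq> \<zero>\<^bsub>K\<^esub>} \<subseteq> {s \<in> S. f s \<noteq> \<zero>\<^bsub>K\<^esub>}"
      using 4 by auto
    ultimately have "finite {s \<in> S. (\<lambda>v\<in>S. c \<otimes>\<^bsub>K\<^esub> f v) s \<noteq> \<zero>\<^bsub>K\<^esub>}"
      by (rule finite_subset[rotated])
    with 4 show ?case by (auto simp: func_space_def PiE_mem)
  qed
  then have "module K (free_space K S)"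
    unfolding free_space_def by (rule F.submodule_is_module)
  with assms show ?thesis by (rule vectorspaceI)
qed

lemma free_gen_closed:
  assumes "field K" and "s \<in> S"
  shows "free_gen K S s \<in> carrier (free_space K S)"
proof -
  interpret field K by fact
  have "{t \<in> S. free_gen K S s t \<noteq> \<zero>\<^bsub>K\<^esub>} \<subseteq> {s}" by (auto simp: free_gen_def)
  then have "finite {t \<in> S. free_gen K S s t \<noteq> \<zero>\<^bsub>K\<^esub>}" by (rule finite_subset) simp
  moreover have "free_gen K S s \<in> S \<rightarrow>\<^sub>E carrier K" by (auto simp: free_gen_def)
  ultimately show ?thesis by (simp add: free_space_simps[OF assms(1)])
qed

lemma linear_extension_eq:
  assumes "vectorspace K P" and b: "b \<in> S \<rightarrow> carrier P" and f: "f \<in> S \<rightarrow>\<^sub>E carrier K"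
    and A: "finite A" "A \<subseteq> S" "{s \<in> S. f s \<noteq> \<zero>\<^bsub>K\<^esub>} \<subseteq> A"
  shows "linear_extension K S P b f = (\<Oplus>\<^bsub>P\<^esub> s \<in> A. f s \<odot>\<^bsub>P\<^esub> b s)"
proof -
  interpret P: vectorspace K P by fact
  have bc: "b s \<in> carrier P" if "s \<in> A" for s
    using b A(2) that by auto
  have "f s \<in> carrier K" if "s \<in> A" for s
    using A(2) that by (intro PiE_mem[OF f]) auto
  then have cl: "f s \<odot>\<^bsub>P\<^esub> b s \<in> carrier P" if "s \<in> A" for s
    using bc that by simp
  have "f s \<odot>\<^bsub>P\<^esub> b s = \<zero>\<^bsub>P\<^esub>" if "s \<in> A - {s \<in> S. f s \<noteq> \<zero>\<^bsub>K\<^esub>}" for s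
    using bc A(2) that by auto
  with cl A show ?thesis unfolding linear_extension_def
    by (intro P.M.add.finprod_mono_neutral_cong_left) blast+
qed

lemma linear_extension_linear:
  assumes "vectorspace K P" and b: "b \<in> S \<rightarrow> carrier P"
  shows "linear_map K (free_space K S) P (linear_extension K S P b)"
proof -
  interpret P: vectorspace K P by fact
  have fld: "field K" by unfold_locales
  interpret F: vectorspace K "free_space K S" by (rule vectorspace_free_space[OF fld])
  note simps = free_space_simps[OF fld]
  have bc: "b s \<in> carrier P" if "s \<in> S" for s using b that by auto
  have fc: "f s \<in> carrier K" if "f \<in> S \<rightarrow>\<^sub>E carrier K" "s \<in> S" for f s
    using that by (rule PiE_mem)
  have cl: "f s \<odot>\<^bsub>P\<^esub> b s \<in> carrier P" if "f \<in> S \<rightarrow>\<^sub>E carrier K" "s \<in> S" for f s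
    using fc[OF that] bc[OF that(2)] by simp
  have "linear_extension K S P b \<in> module_hom K (free_space K S) P"
    unfolding module_hom_def
  proof (intro CollectI conjI allI impI funcsetI)
    fix f assume "f \<in> carrier (free_space K S)"
    then show "linear_extension K S P b f \<in> carrier P"
      unfolding linear_extension_def using cl by (intro P.M.finsum_closed) (auto simp: simps)
  next
    fix f g assume fg: "f \<in> carrier (free_space K S) \<and> g \<in> carrier (free_space K S)"
    let ?A = "{s \<in> S. f s \<noteq> \<zero>\<^bsub>K\<^esub>} \<union> {s \<in> S. g s \<noteq> \<zero>\<^bsub>K\<^esub>}"
    let ?h = "\<lambda>s\<in>S. f s \<oplus>\<^bsub>K\<^esub> g s"
    have f: "f \<in> S \<rightarrow>\<^sub>E carrier K" and g: "g \<in> S \<rightarrow>\<^sub>E carrier K" and fin: "finite ?A"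
      using fg by (auto simp: simps)
    have h: "?h \<in> S \<rightarrow>\<^sub>E carrier K" using f g by (auto simp: PiE_mem)
    have "linear_extension K S P b ?h = (\<Oplus>\<^bsub>P\<^esub> s \<in> ?A. ?h s \<odot>\<^bsub>P\<^esub> b s)"
      by (rule linear_extension_eq[OF assms h fin]) auto
    also have "\<dots> = (\<Oplus>\<^bsub>P\<^esub> s \<in> ?A. f s \<odot>\<^bsub>P\<^esub> b s \<oplus>\<^bsub>P\<^esub> g s \<odot>\<^bsub>P\<^esub> b s)"
      using cl[OF f] cl[OF g] fc[OF f] fc[OF g] bc
      by (intro P.M.finsum_cong') (auto simp: P.smult_l_distr)
    also have "\<dots> = (\<Oplus>\<^bsub>P\<^esub> s \<in> ?A. f s \<odot>\<^bsub>P\<^esub> b s) \<oplus>\<^bsub>P\<^esub> (\<Oplus>\<^bsub>P\<^esub> s \<in> ?A. g s \<odot>\<^bsub>P\<^esub> b s)"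
      using f g cl by (intro P.M.finsum_addf) auto
    also have "(\<Oplus>\<^bsub>P\<^esub> s \<in> ?A. f s \<odot>\<^bsub>P\<^esub> b s) = linear_extension K S P b f"
      by (rule linear_extension_eq[OF assms f fin, symmetric]) auto
    also have "(\<Oplus>\<^bsub>P\<^esub> s \<in> ?A. g s \<odot>\<^bsub>P\<^esub> b s) = linear_extension K S P b g"
      by (rule linear_extension_eq[OF assms g fin, symmetric]) auto
    finally show "linear_extension K S P b (f \<oplus>\<^bsub>free_space K S\<^esub> g)
        = linear_extension K S P b f \<oplus>\<^bsub>P\<^esub> linear_extension K S P b g"
      by (simp only: simps)
  next
    fix c f assume cf: "c \<in> carrier K \<and> f \<in> carrier (free_space K S)"
    let ?A = "{s \<in> S. f s \<noteq> \<zero>\<^bsub>K\<^esub>}"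
    let ?h = "\<lambda>s\<in>S. c \<otimes>\<^bsub>K\<^esub> f s"
    have f: "f \<in> S \<rightarrow>\<^sub>E carrier K" and fin: "finite ?A" using cf by (auto simp: simps)
    have h: "?h \<in> S \<rightarrow>\<^sub>E carrier K" using cf f by (auto simp: PiE_mem)
    have "linear_extension K S P b ?h = (\<Oplus>\<^bsub>P\<^esub> s \<in> ?A. ?h s \<odot>\<^bsub>P\<^esub> b s)"
      using cf by (intro linear_extension_eq[OF assms h fin]) auto
    also have "\<dots> = (\<Oplus>\<^bsub>P\<^esub> s \<in> ?A. c \<odot>\<^bsub>P\<^esub> (f s \<odot>\<^bsub>P\<^esub> b s))"
      using cf cl[OF f] fc[OF f] bc by (intro P.M.finsum_cong') (auto simp: P.smult_assoc1)
    also have "\<dots> = c \<odot>\<^bsub>P\<^esub> linear_extension K S P b f"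
      unfolding linear_extension_def using cf f fin cl
      by (intro P.finsum_smult_ldistr[symmetric]) auto
    finally show "linear_extension K S P b (c \<odot>\<^bsub>free_space K S\<^esub> f)
        = c \<odot>\<^bsub>P\<^esub> linear_extension K S P b f"
      by (simp only: simps)
  qed
  then show ?thesis
    by (intro linear_map.intro mod_hom.intro mod_hom_axioms.intro) unfold_locales
qed

lemma linear_extension_gen:
  assumes "vectorspace K P" and b: "b \<in> S \<rightarrow> carrier P" and s: "s \<in> S"
  shows "linear_extension K S P b (free_gen K S s) = b s"
proof -
  interpret P: vectorspace K P by fact
  have fld: "field K" by unfold_locales
  have bs: "b s \<in> carrier P" using b s by auto
  have "free_gen K S s \<in> S \<rightarrow>\<^sub>E carrier K"
    using free_gen_closed[OF fld s] by (simp add: free_space_simps[OF fld])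
  then have "linear_extension K S P b (free_gen K S s)
      = (\<Oplus>\<^bsub>P\<^esub> t \<in> {s}. free_gen K S s t \<odot>\<^bsub>P\<^esub> b t)"
    using assms by (intro linear_extension_eq) (auto simp: free_gen_def)
  also have "\<dots> = free_gen K S s s \<odot>\<^bsub>P\<^esub> b s"
    using bs s by (subst P.M.finsum_insert) (auto simp: free_gen_def)
  also have "\<dots> = b s" using bs s by (auto simp: free_gen_def)
  finally show ?thesis .
qed

lemma free_space_unique:
  assumes "linear_map K (free_space K S) P h" and "linear_map K (free_space K S) P h'"
    and gen: "\<And>s. s \<in> S \<Longrightarrow> h (free_gen K S s) = h' (free_gen K S s)"
    and f: "f \<in> carrier (free_space K S)"
  shows "h f = h' f"
proof -
  interpret h: linear_map K "free_space K S" P h by fact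
  interpret h': linear_map K "free_space K S" P h' by fact
  have fld: "field K" by unfold_locales
  have K0: "\<zero>\<^bsub>K\<^esub> \<oplus>\<^bsub>K\<^esub> a = a" if "a \<in> carrier K" for a
    using fld that by (simp add: field_def domain_def cring_def ring.ring_simprules)
  note simps = free_space_simps[OF fld]
  have "finite A \<Longrightarrow> A \<subseteq> S \<Longrightarrow> f \<in> carrier (free_space K S) \<Longrightarrow> {s \<in> S. f s \<noteq> \<zero>\<^bsub>K\<^esub>} \<subseteq> A
      \<Longrightarrow> h f = h' f" for A f
  proof (induction A arbitrary: f rule: finite_induct)
    case empty
    then have "f = \<zero>\<^bsub>free_space K S\<^esub>"
      by (auto simp: simps PiE_def extensional_def fun_eq_iff)
    then show ?case by simp
  next
    case (insert s A)
    let ?g = "\<lambda>t\<in>S. if t = s then \<zero>\<^bsub>K\<^esub> else f t"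
    have s: "s \<in> S" using insert by simp
    have fc: "f t \<in> carrier K" if "t \<in> S" for t using insert.prems that by (auto simp: simps)
    then have fs: "f s \<in> carrier K" using s .
    have sub: "{t \<in> S. ?g t \<noteq> \<zero>\<^bsub>K\<^esub>} \<subseteq> A" using insert by auto
    then have g: "?g \<in> carrier (free_space K S)"
      using insert finite_subset[OF sub] by (auto simp: simps PiE_mem)
    have fe: "f = f s \<odot>\<^bsub>free_space K S\<^esub> free_gen K S s \<oplus>\<^bsub>free_space K S\<^esub> ?g"
      using insert.prems fs fc
      by (auto simp: simps free_gen_def PiE_def extensional_def fun_eq_iff Pi_mem K0)
    have "h ?g = h' ?g" using insert g sub by blast
    then show ?case
      using gen[OF s] fs g free_gen_closed[OF fld s]
      by (subst (1 2) fe) simp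
  qed
  with f show ?thesis by (auto simp: simps)
qed

context
  fixes K :: "('k, 'kx) ring_scheme" and V :: "('k, 'v, 'vx) module_scheme" and N
  assumes V: "vectorspace K V" and N: "submodule K N V"
begin

interpretation V: vectorspace K V by (fact V)

lemma submodule_facts:
  shows "N \<subseteq> carrier V" and "\<zero>\<^bsub>V\<^esub> \<in> N"
    and "\<lbrakk>x \<in> N; y \<in> N\<rbrakk> \<Longrightarrow> x \<oplus>\<^bsub>V\<^esub> y \<in> N"
    and "\<lbrakk>c \<in> carrier K; x \<in> N\<rbrakk> \<Longrightarrow> c \<odot>\<^bsub>V\<^esub> x \<in> N"
  using N unfolding submodule_def by blast+

lemma submodule_abelian_subgroup: "abelian_subgroup N V"
proof -
  have "\<ominus>\<^bsub>V\<^esub> x \<in> N" if x: "x \<in> N" for x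
  proof -
    have xV: "x \<in> carrier V" using submodule_facts(1) x by blast
    have "(\<ominus>\<^bsub>K\<^esub> \<one>\<^bsub>K\<^esub>) \<odot>\<^bsub>V\<^esub> x \<in> N" by (rule submodule_facts(4)[OF _ x]) simp
    then show ?thesis using xV by (simp add: V.smult_l_minus)
  qed
  then have "subgroup N (add_monoid V)"
    using submodule_facts(1-3) by (intro subgroup.intro) (simp_all add: a_inv_def)
  then have "additive_subgroup N V" by (rule additive_subgroup.intro)
  then show ?thesis by (rule abelian_subgroupI3) (rule V.M.abelian_group_axioms)
qed

interpretation N: abelian_subgroup N V by (rule submodule_abelian_subgroup)

lemma quotient_space_carrier: "carrier (quotient_space V N) = (\<lambda>v. N +>\<^bsub>V\<^esub> v) ` carrier V"
  by (auto simp: quotient_space_def A_RCOSETS_def')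

lemma quotient_space_zero: "\<zero>\<^bsub>quotient_space V N\<^esub> = N +>\<^bsub>V\<^esub> \<zero>\<^bsub>V\<^esub>"
  by (simp add: quotient_space_def N.a_subset)

lemma quotient_space_add:
  "\<lbrakk>v \<in> carrier V; w \<in> carrier V\<rbrakk> \<Longrightarrow>
    (N +>\<^bsub>V\<^esub> v) \<oplus>\<^bsub>quotient_space V N\<^esub> (N +>\<^bsub>V\<^esub> w) = N +>\<^bsub>V\<^esub> (v \<oplus>\<^bsub>V\<^esub> w)"
  by (simp add: quotient_space_def N.a_rcos_sum)

lemma quotient_space_smult:
  assumes c: "c \<in> carrier K" and v: "v \<in> carrier V"
  shows "c \<odot>\<^bsub>quotient_space V N\<^esub> (N +>\<^bsub>V\<^esub> v) = N +>\<^bsub>V\<^esub> (c \<odot>\<^bsub>V\<^esub> v)"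
proof -
  have eq: "N +>\<^bsub>V\<^esub> (c \<odot>\<^bsub>V\<^esub> x) = N +>\<^bsub>V\<^esub> (c \<odot>\<^bsub>V\<^esub> v)" if x: "x \<in> N +>\<^bsub>V\<^esub> v" for x
  proof -
    obtain n where n: "n \<in> N" and xn: "x = n \<oplus>\<^bsub>V\<^esub> v" using x by (auto simp: a_r_coset_def')
    have nV: "n \<in> carrier V" using n submodule_facts(1) by blast
    have "c \<odot>\<^bsub>V\<^esub> x = c \<odot>\<^bsub>V\<^esub> n \<oplus>\<^bsub>V\<^esub> c \<odot>\<^bsub>V\<^esub> v"
      using c v nV by (simp add: xn V.smult_r_distr)
    moreover have "c \<odot>\<^bsub>V\<^esub> n \<in> N" using c n by (rule submodule_facts(4))
    ultimately have "c \<odot>\<^bsub>V\<^esub> x \<in> N +>\<^bsub>V\<^esub> (c \<odot>\<^bsub>V\<^esub> v)"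
      by (auto simp: a_r_coset_def')
    then have "N +>\<^bsub>V\<^esub> (c \<odot>\<^bsub>V\<^esub> v) = N +>\<^bsub>V\<^esub> (c \<odot>\<^bsub>V\<^esub> x)"
      by (rule N.a_repr_independence'[OF _ V.smult_closed[OF c v]])
    then show ?thesis by simp
  qed
  have "(\<Union>x\<in>N +>\<^bsub>V\<^esub> v. N +>\<^bsub>V\<^esub> (c \<odot>\<^bsub>V\<^esub> x)) = N +>\<^bsub>V\<^esub> (c \<odot>\<^bsub>V\<^esub> v)"
    using eq N.a_rcos_self[OF v] by blast
  then show ?thesis by (simp add: quotient_space_def)
qed

lemma vectorspace_quotient_space: "vectorspace K (quotient_space V N)"
proof (rule vectorspaceI)
  show "field K" by unfold_locales
  note simps = quotient_space_carrier quotient_space_zero quotient_space_add quotient_space_smult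
  have "abelian_group (quotient_space V N)"
  proof (rule abelian_groupI, goal_cases)
    case (6 x)
    then obtain v where v: "v \<in> carrier V" "x = N +>\<^bsub>V\<^esub> v" by (auto simp: simps)
    then show ?case
      by (intro bexI[of _ "N +>\<^bsub>V\<^esub> (\<ominus>\<^bsub>V\<^esub> v)"]) (auto simp: simps V.M.l_neg)
  qed (auto simp: simps V.M.a_ac)
  then show "module K (quotient_space V N)"
    by (rule moduleI[OF V.is_cring])
      (auto simp: simps V.smult_l_distr V.smult_r_distr V.smult_assoc1)
qed

end

context
  fixes K :: "('k, 'kx) ring_scheme" and V :: "('k, 'v, 'vx) module_scheme"
    and W :: "('k, 'w, 'wx) module_scheme"
  assumes V: "vectorspace K V" and W: "vectorspace K W"
begin

interpretation V: vectorspace K V by (fact V)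
interpretation W: vectorspace K W by (fact W)

lemma field_K: "field K" by unfold_locales

interpretation F: vectorspace K "free_space K (carrier V \<times> carrier W)"
  by (rule vectorspace_free_space[OF field_K])

lemma tensor_relations_closed:
  "tensor_relations K V W \<subseteq> carrier (free_space K (carrier V \<times> carrier W))"
  unfolding tensor_relations_def Let_def
  by (auto intro!: F.M.minus_closed F.M.a_closed F.smult_closed free_gen_closed[OF field_K])

lemma tensor_null_submodule:
  "submodule K (tensor_null K V W) (free_space K (carrier V \<times> carrier W))"
  unfolding tensor_null_def by (rule F.span_is_submodule[OF tensor_relations_closed])

theorem vectorspace_tensor_space: "vectorspace K (tensor_space K V W)"
  unfolding tensor_space_def
  by (rule vectorspace_quotient_space[OF F.vectorspace_axioms tensor_null_submodule])

lemma tensor_proj_linear: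
  "linear_map K (free_space K (carrier V \<times> carrier W)) (tensor_space K V W)
     (\<lambda>f. tensor_null K V W +>\<^bsub>free_space K (carrier V \<times> carrier W)\<^esub> f)"
proof -
  note Q = F.vectorspace_axioms tensor_null_submodule
  interpret T: vectorspace K "tensor_space K V W" by (rule vectorspace_tensor_space)
  show ?thesis
    by (intro linear_map.intro mod_hom.intro mod_hom_axioms.intro)
      (unfold_locales, auto simp: module_hom_def tensor_space_def quotient_space_carrier[OF Q]
        quotient_space_add[OF Q] quotient_space_smult[OF Q])
qed

lemma tensor_elem_closed:
  "\<lbrakk>v \<in> carrier V; w \<in> carrier W\<rbrakk> \<Longrightarrow> tensor_elem K V W v w \<in> carrier (tensor_space K V W)"
  unfolding tensor_elem_def
  by (rule mod_hom.f_im[OF linear_map.axioms(3)[OF tensor_proj_linear]])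
    (simp add: free_gen_closed[OF field_K])

context
  fixes P :: "('k, 'p, 'px) module_scheme" and b :: "'v \<Rightarrow> 'w \<Rightarrow> 'p"
  assumes P: "vectorspace K P" and b: "bilinear_map K V W P b"
begin

interpretation P: vectorspace K P by (fact P)

lemma bilinear_closed: "(\<lambda>(v, w). b v w) \<in> carrier V \<times> carrier W \<rightarrow> carrier P"
  using b by (auto simp: bilinear_map_def linear_map_def mod_hom_def mod_hom_axioms_def module_hom_def)

lemma tensor_null_vanish:
  assumes "f \<in> tensor_null K V W"
  shows "linear_extension K (carrier V \<times> carrier W) P (\<lambda>(v, w). b v w) f = \<zero>\<^bsub>P\<^esub>"
proof -
  let ?S = "carrier V \<times> carrier W"
  let ?h = "linear_extension K ?S P (\<lambda>(v, w). b v w)"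
  interpret h: linear_map K "free_space K ?S" P ?h
    by (rule linear_extension_linear[OF P bilinear_closed])
  have hg: "?h (free_gen K ?S (v, w)) = b v w" if "v \<in> carrier V" "w \<in> carrier W" for v w
    using linear_extension_gen[OF P bilinear_closed, of "(v, w)"] that by simp
  have bc: "b v w \<in> carrier P" if "v \<in> carrier V" "w \<in> carrier W" for v w
    using funcset_mem[OF bilinear_closed, of "(v, w)"] that by simp
  have bl: "(\<lambda>v. b v w) \<in> module_hom K V P" if "w \<in> carrier W" for w
    using b that by (simp add: bilinear_map_def linear_map_def mod_hom_def mod_hom_axioms_def)
  have br: "b v \<in> module_hom K W P" if "v \<in> carrier V" for v
    using b that by (simp add: bilinear_map_def linear_map_def mod_hom_def mod_hom_axioms_def)
  have lin_add: "b (v \<oplus>\<^bsub>V\<^esub> v') w = b v w \<oplus>\<^bsub>P\<^esub> b v' w"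
    if "v \<in> carrier V" "v' \<in> carrier V" "w \<in> carrier W" for v v' w
    using module_hom_add[OF bl] that by simp
  have lin_add': "b v (w \<oplus>\<^bsub>W\<^esub> w') = b v w \<oplus>\<^bsub>P\<^esub> b v w'"
    if "v \<in> carrier V" "w \<in> carrier W" "w' \<in> carrier W" for v w w'
    using module_hom_add[OF br] that by simp
  have lin_smult: "b (c \<odot>\<^bsub>V\<^esub> v) w = c \<odot>\<^bsub>P\<^esub> b v w"
    if "c \<in> carrier K" "v \<in> carrier V" "w \<in> carrier W" for c v w
    using module_hom_smult[OF bl] that by simp
  have lin_smult': "b v (c \<odot>\<^bsub>W\<^esub> w) = c \<odot>\<^bsub>P\<^esub> b v w"
    if "c \<in> carrier K" "v \<in> carrier V" "w \<in> carrier W" for c v w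
    using module_hom_smult[OF br] that by simp
  let ?F = "free_space K ?S" and ?g = "free_gen K ?S"
  have gc: "?g (v, w) \<in> carrier ?F" if "v \<in> carrier V" "w \<in> carrier W" for v w
    using that by (intro free_gen_closed[OF field_K]) simp
  have ker: "x \<ominus>\<^bsub>?F\<^esub> y \<in> h.ker"
    if "x \<in> carrier ?F" "y \<in> carrier ?F" "?h x = ?h y" for x y
    using that by (simp add: h.ker_def h.f_minus P.M.r_neg P.M.minus_eq)
  have k1: "?g (v \<oplus>\<^bsub>V\<^esub> v', w) \<ominus>\<^bsub>?F\<^esub> (?g (v, w) \<oplus>\<^bsub>?F\<^esub> ?g (v', w)) \<in> h.ker"
    if "v \<in> carrier V" "v' \<in> carrier V" "w \<in> carrier W" for v v' w
    using that by (intro ker) (simp_all add: gc hg lin_add lin_add')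
  have k2: "?g (v, w \<oplus>\<^bsub>W\<^esub> w') \<ominus>\<^bsub>?F\<^esub> (?g (v, w) \<oplus>\<^bsub>?F\<^esub> ?g (v, w')) \<in> h.ker"
    if "v \<in> carrier V" "w \<in> carrier W" "w' \<in> carrier W" for v w w'
    using that by (intro ker) (simp_all add: gc hg lin_add lin_add')
  have k3: "?g (c \<odot>\<^bsub>V\<^esub> v, w) \<ominus>\<^bsub>?F\<^esub> (c \<odot>\<^bsub>?F\<^esub> ?g (v, w)) \<in> h.ker"
    if "c \<in> carrier K" "v \<in> carrier V" "w \<in> carrier W" for c v w
    using that by (intro ker) (simp_all add: gc hg lin_smult lin_smult')
  have k4: "?g (v, c \<odot>\<^bsub>W\<^esub> w) \<ominus>\<^bsub>?F\<^esub> (c \<odot>\<^bsub>?F\<^esub> ?g (v, w)) \<in> h.ker"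
    if "c \<in> carrier K" "v \<in> carrier V" "w \<in> carrier W" for c v w
    using that by (intro ker) (simp_all add: gc hg lin_smult lin_smult')
  have "tensor_relations K V W \<subseteq> h.ker"
    unfolding tensor_relations_def Let_def
    by (intro Un_least subsetI; elim CollectE exE conjE; simp only: k1 k2 k3 k4)
  then have "tensor_null K V W \<subseteq> h.ker"
    unfolding tensor_null_def by (rule F.span_is_subset[OF _ h.ker_is_submodule])
  with assms show ?thesis by (auto simp: h.ker_def)
qed

lemma tensor_lift_coset:
  assumes f: "f \<in> carrier (free_space K (carrier V \<times> carrier W))"
  shows "tensor_lift K V W P b (tensor_null K V W +>\<^bsub>free_space K (carrier V \<times> carrier W)\<^esub> f)
    = linear_extension K (carrier V \<times> carrier W) P (\<lambda>(v, w). b v w) f"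
proof -
  let ?S = "carrier V \<times> carrier W"
  let ?h = "linear_extension K ?S P (\<lambda>(v, w). b v w)"
  interpret h: linear_map K "free_space K ?S" P ?h
    by (rule linear_extension_linear[OF P bilinear_closed])
  interpret N: abelian_subgroup "tensor_null K V W" "free_space K ?S"
    by (rule submodule_abelian_subgroup[OF F.vectorspace_axioms tensor_null_submodule])
  have eq: "?h x = ?h f" if x: "x \<in> tensor_null K V W +>\<^bsub>free_space K ?S\<^esub> f" for x
  proof -
    obtain n where n: "n \<in> tensor_null K V W" and xn: "x = n \<oplus>\<^bsub>free_space K ?S\<^esub> f"
      using x unfolding a_r_coset_def' by blast
    have "n \<in> carrier (free_space K ?S)" using n by (rule N.a_Hcarr)
    then have "?h x = ?h n \<oplus>\<^bsub>P\<^esub> ?h f" unfolding xn using f by (rule h.f_add)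
    also have "?h n = \<zero>\<^bsub>P\<^esub>" using n by (rule tensor_null_vanish)
    also have "\<zero>\<^bsub>P\<^esub> \<oplus>\<^bsub>P\<^esub> ?h f = ?h f" using h.f_im[OF f] by (rule P.M.l_zero)
    finally show ?thesis .
  qed
  have "?h ` (tensor_null K V W +>\<^bsub>free_space K ?S\<^esub> f)
      = (\<lambda>_. ?h f) ` (tensor_null K V W +>\<^bsub>free_space K ?S\<^esub> f)"
    by (rule image_cong[OF refl eq])
  also have "\<dots> = {?h f}" using N.a_rcos_self[OF f] by (rule image_constant)
  finally have im: "?h ` (tensor_null K V W +>\<^bsub>free_space K ?S\<^esub> f) = {?h f}" .
  show ?thesis unfolding tensor_lift_def im by (rule the_elem_eq)
qed

theorem tensor_lift_elem:
  "\<lbrakk>v \<in> carrier V; w \<in> carrier W\<rbrakk> \<Longrightarrow> tensor_lift K V W P b (tensor_elem K V W v w) = b v w"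
  using tensor_lift_coset[OF free_gen_closed[OF field_K, of "(v, w)"]]
    linear_extension_gen[OF P bilinear_closed, of "(v, w)"]
  by (simp add: tensor_elem_def)

theorem tensor_lift_linear: "linear_map K (tensor_space K V W) P (tensor_lift K V W P b)"
proof -
  let ?S = "carrier V \<times> carrier W"
  let ?h = "linear_extension K ?S P (\<lambda>(v, w). b v w)"
  note Q = F.vectorspace_axioms tensor_null_submodule
  interpret h: linear_map K "free_space K ?S" P ?h
    by (rule linear_extension_linear[OF P bilinear_closed])
  interpret T: vectorspace K "tensor_space K V W" by (rule vectorspace_tensor_space)
  show ?thesis
    by (intro linear_map.intro mod_hom.intro mod_hom_axioms.intro)
      (unfold_locales, auto simp: module_hom_def tensor_space_def quotient_space_carrier[OF Q]
        quotient_space_add[OF Q] quotient_space_smult[OF Q] tensor_lift_coset)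
qed

end

theorem tensor_space_unique:
  assumes "linear_map K (tensor_space K V W) P h" and "linear_map K (tensor_space K V W) P h'"
    and elem: "\<And>v w. \<lbrakk>v \<in> carrier V; w \<in> carrier W\<rbrakk> \<Longrightarrow>
      h (tensor_elem K V W v w) = h' (tensor_elem K V W v w)"
    and t: "t \<in> carrier (tensor_space K V W)"
  shows "h t = h' t"
proof -
  let ?S = "carrier V \<times> carrier W"
  let ?p = "\<lambda>f. tensor_null K V W +>\<^bsub>free_space K ?S\<^esub> f"
  interpret p: linear_map K "free_space K ?S" "tensor_space K V W" ?p by (rule tensor_proj_linear)
  have comp: "linear_map K (free_space K ?S) P (\<lambda>f. k (?p f))"
    if "linear_map K (tensor_space K V W) P k" for k
  proof -
    interpret k: linear_map K "tensor_space K V W" P k by fact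
    show ?thesis
      by (intro linear_map.intro mod_hom.intro mod_hom_axioms.intro)
        (unfold_locales, auto simp: module_hom_def)
  qed
  obtain f where f: "f \<in> carrier (free_space K ?S)" "t = ?p f"
    using t by (auto simp: tensor_space_def
        quotient_space_carrier[OF F.vectorspace_axioms tensor_null_submodule])
  have "h (?p f) = h' (?p f)"
    by (rule free_space_unique[OF comp comp _ f(1)])
      (use assms in \<open>auto simp: tensor_elem_def[symmetric]\<close>)
  then show ?thesis by (simp add: f)
qed

end

definition tensor_map ::
  "('k, 'kx) ring_scheme \<Rightarrow> ('k, 'v, 'vx) module_scheme \<Rightarrow> ('k, 'w, 'wx) module_scheme \<Rightarrow>
   ('k, 'p, 'px) module_scheme \<Rightarrow> ('k, 'q, 'qx) module_scheme \<Rightarrow> ('v \<Rightarrow> 'p) \<Rightarrow> ('w \<Rightarrow> 'q) \<Rightarrow>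
   ('v \<times> 'w \<Rightarrow> 'k) set \<Rightarrow> ('p \<times> 'q \<Rightarrow> 'k) set" where
  "tensor_map K V W P Q f g =
     tensor_lift K V W (tensor_space K P Q) (\<lambda>v w. tensor_elem K P Q (f v) (g w))"

subsection \<open>The Hom-Yang-Baxter equation\<close>

text \<open>
  The threefold tensor power of \<open>V\<close> is bracketed to the left. A map on the
  right-bracketed power is transported along the canonical isomorphisms
  \<open>(x \<otimes> y) \<otimes> z \<mapsto> x \<otimes> (y \<otimes> z)\<close> and back.
\<close>

definition tensor_assoc ::
  "('k, 'kx) ring_scheme \<Rightarrow> ('k, 'v, 'vx) module_scheme \<Rightarrow>
   (('v \<times> 'v \<Rightarrow> 'k) set \<times> 'v \<Rightarrow> 'k) set \<Rightarrow> ('v \<times> ('v \<times> 'v \<Rightarrow> 'k) set \<Rightarrow> 'k) set" where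
  "tensor_assoc K V =
     (let T = tensor_space K V V; P = tensor_space K V T
      in tensor_lift K T V P
           (\<lambda>t z. tensor_lift K V V P
              (\<lambda>x y. tensor_elem K V T x (tensor_elem K V V y z)) t))"

definition tensor_assoc_inv ::
  "('k, 'kx) ring_scheme \<Rightarrow> ('k, 'v, 'vx) module_scheme \<Rightarrow>
   ('v \<times> ('v \<times> 'v \<Rightarrow> 'k) set \<Rightarrow> 'k) set \<Rightarrow> (('v \<times> 'v \<Rightarrow> 'k) set \<times> 'v \<Rightarrow> 'k) set" where
  "tensor_assoc_inv K V =
     (let T = tensor_space K V V; P = tensor_space K T V
      in tensor_lift K V T P
           (\<lambda>x t. tensor_lift K V V P
              (\<lambda>y z. tensor_elem K T V (tensor_elem K V V x y) z) t))"

text \<open>\<open>hom_left\<close> is \<open>B \<otimes> \<alpha>\<close> and \<open>hom_right\<close> is \<open>\<alpha> \<otimes> B\<close>.\<close>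

definition hom_left ::
  "('k, 'kx) ring_scheme \<Rightarrow> ('k, 'v, 'vx) module_scheme \<Rightarrow> ('v \<Rightarrow> 'v) \<Rightarrow>
   (('v \<times> 'v \<Rightarrow> 'k) set \<Rightarrow> ('v \<times> 'v \<Rightarrow> 'k) set) \<Rightarrow>
   (('v \<times> 'v \<Rightarrow> 'k) set \<times> 'v \<Rightarrow> 'k) set \<Rightarrow> (('v \<times> 'v \<Rightarrow> 'k) set \<times> 'v \<Rightarrow> 'k) set" where
  "hom_left K V \<alpha> B =
     tensor_map K (tensor_space K V V) V (tensor_space K V V) V B \<alpha>"

definition hom_right ::
  "('k, 'kx) ring_scheme \<Rightarrow> ('k, 'v, 'vx) module_scheme \<Rightarrow> ('v \<Rightarrow> 'v) \<Rightarrow>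
   (('v \<times> 'v \<Rightarrow> 'k) set \<Rightarrow> ('v \<times> 'v \<Rightarrow> 'k) set) \<Rightarrow>
   (('v \<times> 'v \<Rightarrow> 'k) set \<times> 'v \<Rightarrow> 'k) set \<Rightarrow> (('v \<times> 'v \<Rightarrow> 'k) set \<times> 'v \<Rightarrow> 'k) set" where
  "hom_right K V \<alpha> B =
     tensor_assoc_inv K V
     \<circ> tensor_map K V (tensor_space K V V) V (tensor_space K V V) \<alpha> B
     \<circ> tensor_assoc K V"

definition hybe_solution ::
  "('k, 'kx) ring_scheme \<Rightarrow> ('k, 'v, 'vx) module_scheme \<Rightarrow> ('v \<Rightarrow> 'v) \<Rightarrow>
   (('v \<times> 'v \<Rightarrow> 'k) set \<Rightarrow> ('v \<times> 'v \<Rightarrow> 'k) set) \<Rightarrow> bool" where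
  "hybe_solution K V \<alpha> B \<longleftrightarrow>
     linear_map K V V \<alpha> \<and>
     linear_map K (tensor_space K V V) (tensor_space K V V) B \<and>
     (\<forall>t \<in> carrier (tensor_space K V V).
        tensor_map K V V V V \<alpha> \<alpha> (B t) = B (tensor_map K V V V V \<alpha> \<alpha> t)) \<and>
     (\<forall>t \<in> carrier (tensor_space K (tensor_space K V V) V).
        (hom_right K V \<alpha> B \<circ> hom_left K V \<alpha> B \<circ> hom_right K V \<alpha> B) t =
        (hom_left K V \<alpha> B \<circ> hom_right K V \<alpha> B \<circ> hom_left K V \<alpha> B) t)"

subsection \<open>Hom-Lie algebras\<close>

locale hom_lie_algebra = vectorspace K L
  for K :: "('k, 'kx) ring_scheme" and L :: "('k, 'v, 'vx) module_scheme" +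
  fixes bracket :: "'v \<Rightarrow> 'v \<Rightarrow> 'v" and \<alpha> :: "'v \<Rightarrow> 'v"
  assumes bracket_bilinear: "bilinear_map K L L L bracket"
    and twist_linear: "linear_map K L L \<alpha>"
    and twist_bracket: "\<lbrakk>x \<in> carrier L; y \<in> carrier L\<rbrakk> \<Longrightarrow>
      \<alpha> (bracket x y) = bracket (\<alpha> x) (\<alpha> y)"
    and skew_symmetry: "\<lbrakk>x \<in> carrier L; y \<in> carrier L\<rbrakk> \<Longrightarrow>
      bracket x y = \<ominus>\<^bsub>L\<^esub> bracket y x"
    and hom_jacobi: "\<lbrakk>x \<in> carrier L; y \<in> carrier L; z \<in> carrier L\<rbrakk> \<Longrightarrow>
      bracket (\<alpha> x) (bracket y z) \<oplus>\<^bsub>L\<^esub> bracket (\<alpha> y) (bracket z x)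
        \<oplus>\<^bsub>L\<^esub> bracket (\<alpha> z) (bracket x y) = \<zero>\<^bsub>L\<^esub>"

definition hom_lie_center ::
  "('k, 'v, 'vx) module_scheme \<Rightarrow> ('v \<Rightarrow> 'v \<Rightarrow> 'v) \<Rightarrow> 'v set" where
  "hom_lie_center L bracket =
     {u \<in> carrier L. \<forall>x \<in> carrier L. bracket u x = \<zero>\<^bsub>L\<^esub>}"

definition hom_lie_B ::
  "('k, 'kx) ring_scheme \<Rightarrow> ('k, 'v, 'vx) module_scheme \<Rightarrow> ('v \<Rightarrow> 'v \<Rightarrow> 'v) \<Rightarrow> ('v \<Rightarrow> 'v) \<Rightarrow>
   'v \<Rightarrow> 'k \<Rightarrow> ('v \<times> 'v \<Rightarrow> 'k) set \<Rightarrow> ('v \<times> 'v \<Rightarrow> 'k) set" where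
  "hom_lie_B K L bracket \<alpha> u c =
     tensor_lift K L L (tensor_space K L L)
       (\<lambda>x y. (c \<odot>\<^bsub>tensor_space K L L\<^esub> tensor_elem K L L (bracket x y) u)
          \<ominus>\<^bsub>tensor_space K L L\<^esub> tensor_elem K L L (\<alpha> y) (\<alpha> x))"

definition hom_lie_B_inv ::
  "('k, 'kx) ring_scheme \<Rightarrow> ('k, 'v, 'vx) module_scheme \<Rightarrow> ('v \<Rightarrow> 'v \<Rightarrow> 'v) \<Rightarrow> ('v \<Rightarrow> 'v) \<Rightarrow>
   'v \<Rightarrow> 'k \<Rightarrow> ('v \<times> 'v \<Rightarrow> 'k) set \<Rightarrow> ('v \<times> 'v \<Rightarrow> 'k) set" where
  "hom_lie_B_inv K L bracket \<alpha> u c =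
     tensor_lift K L L (tensor_space K L L)
       (\<lambda>x y. (c \<odot>\<^bsub>tensor_space K L L\<^esub> tensor_elem K L L u (bracket x y))
          \<ominus>\<^bsub>tensor_space K L L\<^esub> tensor_elem K L L (\<alpha> y) (\<alpha> x))"

end

theory Submission
  imports Defs
begin

text \<open>
  All maps involved are linear, so every identity is checked on elementary tensors, and on
  triples \<open>x \<otimes> y \<otimes> z\<close> the braid relation becomes a finite computation. Write \<open>l\<close> for \<open>B \<otimes> \<alpha>\<close>
  and \<open>r\<close> for \<open>\<alpha> \<otimes> B\<close>. Because \<open>u\<close> is central and fixed by \<open>\<alpha>\<close>, every summand containing a
  bracket with \<open>u\<close> vanishes, and what is left of \<open>r l r\<close> and of \<open>l r l\<close> is, term by term, the
  same, except for the coefficient of \<open>c\<^sup>2\<close>. There \<open>r l r\<close> has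
  \<open>- \<alpha>[\<alpha> x, [y, z]] \<otimes> u \<otimes> u\<close> and \<open>l r l\<close> has
  \<open>- \<alpha>([[x, y], \<alpha> z] + [\<alpha> y, [x, z]]) \<otimes> u \<otimes> u\<close>; the two agree by the Hom-Jacobi identity,
  read as a twisted Leibniz rule (\<open>hom_leibniz\<close>). This is \<open>B_braid\<close>.

  If \<open>\<alpha>\<close> is an involution, the formula for the inverse is checked on \<open>x \<otimes> y\<close>: the terms in
  \<open>c\<^sup>2\<close> die by centrality, those in \<open>c\<close> cancel by skew symmetry, and \<open>x \<otimes> y\<close> remains. Its
  braid relation follows from that of \<open>B\<close>. Since \<open>\<alpha>\<close> is its own inverse, \<open>B\<inverse> \<otimes> \<alpha>\<close> and
  \<open>\<alpha> \<otimes> B\<inverse>\<close> are the inverses of \<open>l\<close> and \<open>r\<close>, and inverting both sides of \<open>r l r = l r l\<close> gives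
  the braid relation for \<open>B\<inverse>\<close> (\<open>hybe_solution_inverse\<close>).

  The remaining work is multilinear algebra: elementary tensors are bilinear in their factors,
  tensor products of mutually inverse maps are mutually inverse, and the two bracketings of the
  threefold power are identified by mutually inverse linear maps.
\<close>

section \<open>Linear and bilinear maps\<close>

lemma linear_mapI:
  assumes "vectorspace K V" and "vectorspace K W"
    and "\<And>x. x \<in> carrier V \<Longrightarrow> f x \<in> carrier W"
    and "\<And>x y. \<lbrakk>x \<in> carrier V; y \<in> carrier V\<rbrakk> \<Longrightarrow> f (x \<oplus>\<^bsub>V\<^esub> y) = f x \<oplus>\<^bsub>W\<^esub> f y"
    and "\<And>a x. \<lbrakk>a \<in> carrier K; x \<in> carrier V\<rbrakk> \<Longrightarrow> f (a \<odot>\<^bsub>V\<^esub> x) = a \<odot>\<^bsub>W\<^esub> f x"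
  shows "linear_map K V W f"
proof -
  interpret V: vectorspace K V by fact
  interpret W: vectorspace K W by fact
  show ?thesis
    by (intro linear_map.intro mod_hom.intro mod_hom_axioms.intro)
      (unfold_locales, auto simp: module_hom_def assms)
qed

lemma linear_mapD:
  assumes "linear_map K V W f"
  shows "vectorspace K V" and "vectorspace K W"
    and "x \<in> carrier V \<Longrightarrow> f x \<in> carrier W"
    and "\<lbrakk>x \<in> carrier V; y \<in> carrier V\<rbrakk> \<Longrightarrow> f (x \<oplus>\<^bsub>V\<^esub> y) = f x \<oplus>\<^bsub>W\<^esub> f y"
    and "\<lbrakk>x \<in> carrier V; y \<in> carrier V\<rbrakk> \<Longrightarrow> f (x \<ominus>\<^bsub>V\<^esub> y) = f x \<ominus>\<^bsub>W\<^esub> f y"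
    and "x \<in> carrier V \<Longrightarrow> f (\<ominus>\<^bsub>V\<^esub> x) = \<ominus>\<^bsub>W\<^esub> f x"
    and "\<lbrakk>a \<in> carrier K; x \<in> carrier V\<rbrakk> \<Longrightarrow> f (a \<odot>\<^bsub>V\<^esub> x) = a \<odot>\<^bsub>W\<^esub> f x"
    and "f \<zero>\<^bsub>V\<^esub> = \<zero>\<^bsub>W\<^esub>"
proof -
  interpret linear_map K V W f by fact
  show "vectorspace K V" and "vectorspace K W"
    and "x \<in> carrier V \<Longrightarrow> f x \<in> carrier W"
    and "\<lbrakk>x \<in> carrier V; y \<in> carrier V\<rbrakk> \<Longrightarrow> f (x \<oplus>\<^bsub>V\<^esub> y) = f x \<oplus>\<^bsub>W\<^esub> f y"
    and "\<lbrakk>x \<in> carrier V; y \<in> carrier V\<rbrakk> \<Longrightarrow> f (x \<ominus>\<^bsub>V\<^esub> y) = f x \<ominus>\<^bsub>W\<^esub> f y"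
    and "x \<in> carrier V \<Longrightarrow> f (\<ominus>\<^bsub>V\<^esub> x) = \<ominus>\<^bsub>W\<^esub> f x"
    and "\<lbrakk>a \<in> carrier K; x \<in> carrier V\<rbrakk> \<Longrightarrow> f (a \<odot>\<^bsub>V\<^esub> x) = a \<odot>\<^bsub>W\<^esub> f x"
    and "f \<zero>\<^bsub>V\<^esub> = \<zero>\<^bsub>W\<^esub>"
    by (rule V.vectorspace_axioms W.vectorspace_axioms | simp)+
qed

lemma linear_map_ident: "vectorspace K V \<Longrightarrow> linear_map K V V (\<lambda>x. x)"
  by (rule linear_mapI) simp_all

lemma linear_map_comp:
  assumes "linear_map K V W f" and "linear_map K W P g"
  shows "linear_map K V P (\<lambda>x. g (f x))"
  by (rule linear_mapI) (simp_all add: linear_mapD[OF assms(1)] linear_mapD[OF assms(2)])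

lemma linear_map_add:
  assumes "linear_map K V W f" and "linear_map K V W g"
  shows "linear_map K V W (\<lambda>x. f x \<oplus>\<^bsub>W\<^esub> g x)"
proof -
  interpret W: vectorspace K W by (rule linear_mapD(2)[OF assms(1)])
  show ?thesis
    by (rule linear_mapI)
      (simp_all add: linear_mapD[OF assms(1)] linear_mapD[OF assms(2)] W.M.a_ac W.smult_r_distr)
qed

lemma linear_map_smult:
  assumes "linear_map K V W f" and "a \<in> carrier K"
  shows "linear_map K V W (\<lambda>x. a \<odot>\<^bsub>W\<^esub> f x)"
proof -
  interpret W: vectorspace K W by (rule linear_mapD(2)[OF assms(1)])
  show ?thesis
    using assms(2)
    by (intro linear_mapI)
      (simp_all add: linear_mapD[OF assms(1)] W.smult_r_distr W.smult_assoc1[symmetric] W.R.m_comm)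
qed

lemma linear_map_diff:
  assumes "linear_map K V W f" and "linear_map K V W g"
  shows "linear_map K V W (\<lambda>x. f x \<ominus>\<^bsub>W\<^esub> g x)"
proof -
  interpret W: vectorspace K W by (rule linear_mapD(2)[OF assms(1)])
  show ?thesis
    by (rule linear_mapI)
      (simp_all add: linear_mapD[OF assms(1)] linear_mapD[OF assms(2)] W.M.minus_eq W.M.a_ac
        W.M.minus_add W.smult_r_distr W.smult_r_minus)
qed

lemma bilinear_mapI:
  assumes "\<And>v. v \<in> carrier V \<Longrightarrow> linear_map K W P (b v)"
    and "\<And>w. w \<in> carrier W \<Longrightarrow> linear_map K V P (\<lambda>v. b v w)"
  shows "bilinear_map K V W P b"
  using assms by (simp add: bilinear_map_def)

lemma bilinear_mapD:
  assumes "bilinear_map K V W P b"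
  shows "v \<in> carrier V \<Longrightarrow> linear_map K W P (b v)"
    and "w \<in> carrier W \<Longrightarrow> linear_map K V P (\<lambda>v. b v w)"
  using assms by (simp_all add: bilinear_map_def)

lemma bilinear_map_swap:
  "bilinear_map K V W P b \<Longrightarrow> bilinear_map K W V P (\<lambda>w v. b v w)"
  by (simp add: bilinear_map_def)

section \<open>Maps between tensor products\<close>

text \<open>
  Each relation that expresses bilinearity is among the generators of the null space, so its two
  sides have the same coset.
\<close>

lemma tensor_elem_bilinear:
  assumes V: "vectorspace K V" and W: "vectorspace K W"
  shows "bilinear_map K V W (tensor_space K V W) (tensor_elem K V W)"
proof -
  interpret V: vectorspace K V by fact
  interpret W: vectorspace K W by fact
  let ?S = "carrier V \<times> carrier W"
  let ?F = "free_space K ?S" and ?N = "tensor_null K V W" and ?g = "free_gen K ?S"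
  let ?T = "tensor_space K V W" and ?p = "\<lambda>f. ?N +>\<^bsub>?F\<^esub> f"
  have K: "field K" by unfold_locales
  interpret F: vectorspace K ?F by (rule vectorspace_free_space[OF K])
  interpret T: vectorspace K ?T by (rule vectorspace_tensor_space[OF V W])
  interpret N: abelian_subgroup ?N ?F
    by (rule submodule_abelian_subgroup[OF F.vectorspace_axioms tensor_null_submodule[OF V W]])
  interpret p: linear_map K ?F ?T ?p by (rule tensor_proj_linear[OF V W])
  have g: "?g (v, w) \<in> carrier ?F" if "v \<in> carrier V" "w \<in> carrier W" for v w
    using that by (intro free_gen_closed[OF K]) simp
  have p_eq: "?p x = ?p y"
    if x: "x \<in> carrier ?F" and y: "y \<in> carrier ?F"
      and r: "x \<ominus>\<^bsub>?F\<^esub> y \<in> tensor_relations K V W" for x y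
  proof -
    have "x \<ominus>\<^bsub>?F\<^esub> y \<in> ?N"
      using r F.in_own_span[OF tensor_relations_closed[OF V W]] by (auto simp: tensor_null_def)
    then have "?p (x \<ominus>\<^bsub>?F\<^esub> y) = \<zero>\<^bsub>?T\<^esub>"
      by (simp add: N.a_rcos_const tensor_space_def quotient_space_def)
    then have "?p x \<ominus>\<^bsub>?T\<^esub> ?p y = \<zero>\<^bsub>?T\<^esub>" using x y by simp
    then show ?thesis using x y by simp
  qed
  have rel1: "\<lbrakk>v \<in> carrier V; v' \<in> carrier V; w \<in> carrier W\<rbrakk> \<Longrightarrow>
      ?g (v \<oplus>\<^bsub>V\<^esub> v', w) \<ominus>\<^bsub>?F\<^esub> (?g (v, w) \<oplus>\<^bsub>?F\<^esub> ?g (v', w)) \<in> tensor_relations K V W"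
    and rel2: "\<lbrakk>v \<in> carrier V; w \<in> carrier W; w' \<in> carrier W\<rbrakk> \<Longrightarrow>
      ?g (v, w \<oplus>\<^bsub>W\<^esub> w') \<ominus>\<^bsub>?F\<^esub> (?g (v, w) \<oplus>\<^bsub>?F\<^esub> ?g (v, w')) \<in> tensor_relations K V W"
    and rel3: "\<lbrakk>a \<in> carrier K; v \<in> carrier V; w \<in> carrier W\<rbrakk> \<Longrightarrow>
      ?g (a \<odot>\<^bsub>V\<^esub> v, w) \<ominus>\<^bsub>?F\<^esub> (a \<odot>\<^bsub>?F\<^esub> ?g (v, w)) \<in> tensor_relations K V W"
    and rel4: "\<lbrakk>a \<in> carrier K; v \<in> carrier V; w \<in> carrier W\<rbrakk> \<Longrightarrow>
      ?g (v, a \<odot>\<^bsub>W\<^esub> w) \<ominus>\<^bsub>?F\<^esub> (a \<odot>\<^bsub>?F\<^esub> ?g (v, w)) \<in> tensor_relations K V W"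
    for v v' w w' a
    unfolding tensor_relations_def Let_def by blast+
  note closed = tensor_elem_closed[OF V W]
  note eqs = rel1[THEN p_eq[rotated 2]] rel2[THEN p_eq[rotated 2]]
    rel3[THEN p_eq[rotated 2]] rel4[THEN p_eq[rotated 2]]
  show ?thesis
  proof (rule bilinear_mapI; rule linear_mapI)
  qed (simp_all add: V W T.vectorspace_axioms closed, simp_all add: tensor_elem_def g eqs)
qed

text \<open>
  A family of bilinear maps that depends linearly on a parameter has lifts that depend linearly on
  it: both sides of additivity and homogeneity are linear in the tensor, and they agree on
  elementary tensors. The associativity maps are nested lifts of this kind.
\<close>

lemma tensor_lift_bilinear:
  assumes V: "vectorspace K V" and W: "vectorspace K W"
    and X: "vectorspace K X" and P: "vectorspace K P"
    and b: "\<And>z. z \<in> carrier X \<Longrightarrow> bilinear_map K V W P (b z)"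
    and lin: "\<And>x y. \<lbrakk>x \<in> carrier V; y \<in> carrier W\<rbrakk> \<Longrightarrow> linear_map K X P (\<lambda>z. b z x y)"
  shows "bilinear_map K (tensor_space K V W) X P (\<lambda>t z. tensor_lift K V W P (b z) t)"
proof (rule bilinear_mapI)
  fix t assume t: "t \<in> carrier (tensor_space K V W)"
  interpret X: vectorspace K X by fact
  note lift = tensor_lift_linear[OF V W P b] and elem = tensor_lift_elem[OF V W P b]
  show "linear_map K X P (\<lambda>z. tensor_lift K V W P (b z) t)"
  proof (rule linear_mapI[OF X P])
    fix z assume "z \<in> carrier X"
    then show "tensor_lift K V W P (b z) t \<in> carrier P"
      by (rule linear_mapD(3)[OF lift t])
  next
    fix z z' assume z: "z \<in> carrier X" "z' \<in> carrier X"
    show "tensor_lift K V W P (b (z \<oplus>\<^bsub>X\<^esub> z')) t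
        = tensor_lift K V W P (b z) t \<oplus>\<^bsub>P\<^esub> tensor_lift K V W P (b z') t"
      using z by (intro tensor_space_unique[OF V W lift linear_map_add[OF lift lift] _ t])
        (simp_all add: elem linear_mapD(4)[OF lin])
  next
    fix a z assume az: "a \<in> carrier K" "z \<in> carrier X"
    show "tensor_lift K V W P (b (a \<odot>\<^bsub>X\<^esub> z)) t = a \<odot>\<^bsub>P\<^esub> tensor_lift K V W P (b z) t"
      using az by (intro tensor_space_unique[OF V W lift linear_map_smult[OF lift] _ t])
        (simp_all add: elem linear_mapD(7)[OF lin])
  qed
qed (rule tensor_lift_linear[OF V W P b])

lemma tensor_map_bilinear:
  assumes f: "linear_map K V P f" and g: "linear_map K W Q g"
  shows "bilinear_map K V W (tensor_space K P Q) (\<lambda>v w. tensor_elem K P Q (f v) (g w))"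
proof -
  note e = bilinear_mapD[OF tensor_elem_bilinear[OF linear_mapD(2)[OF f] linear_mapD(2)[OF g]]]
  show ?thesis
  proof (rule bilinear_mapI)
    fix v assume "v \<in> carrier V"
    then show "linear_map K W (tensor_space K P Q) (\<lambda>w. tensor_elem K P Q (f v) (g w))"
      by (intro linear_map_comp[OF g] e(1) linear_mapD(3)[OF f])
  next
    fix w assume "w \<in> carrier W"
    then show "linear_map K V (tensor_space K P Q) (\<lambda>v. tensor_elem K P Q (f v) (g w))"
      by (intro linear_map_comp[OF f, of _ "\<lambda>p. tensor_elem K P Q p (g w)"] e(2)
          linear_mapD(3)[OF g])
  qed
qed

lemma
  assumes f: "linear_map K V P f" and g: "linear_map K W Q g"
  shows tensor_map_linear:
      "linear_map K (tensor_space K V W) (tensor_space K P Q) (tensor_map K V W P Q f g)"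
    and tensor_map_elem: "\<lbrakk>v \<in> carrier V; w \<in> carrier W\<rbrakk> \<Longrightarrow>
      tensor_map K V W P Q f g (tensor_elem K V W v w) = tensor_elem K P Q (f v) (g w)"
proof -
  note PQ = vectorspace_tensor_space[OF linear_mapD(2)[OF f] linear_mapD(2)[OF g]]
  note lift = linear_mapD(1)[OF f] linear_mapD(1)[OF g] PQ tensor_map_bilinear[OF f g]
  show "linear_map K (tensor_space K V W) (tensor_space K P Q) (tensor_map K V W P Q f g)"
    unfolding tensor_map_def by (rule tensor_lift_linear[OF lift])
  show "tensor_map K V W P Q f g (tensor_elem K V W v w) = tensor_elem K P Q (f v) (g w)"
    if "v \<in> carrier V" "w \<in> carrier W"
    unfolding tensor_map_def using that by (rule tensor_lift_elem[OF lift])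
qed

lemma tensor_map_inverse:
  assumes f: "linear_map K V P f" and g: "linear_map K W Q g"
    and f': "linear_map K P V f'" and g': "linear_map K Q W g'"
    and "\<And>v. v \<in> carrier V \<Longrightarrow> f' (f v) = v" and "\<And>w. w \<in> carrier W \<Longrightarrow> g' (g w) = w"
    and t: "t \<in> carrier (tensor_space K V W)"
  shows "tensor_map K P Q V W f' g' (tensor_map K V W P Q f g t) = t"
proof -
  note V = linear_mapD(1)[OF f] and W = linear_mapD(1)[OF g]
  show ?thesis
    by (rule tensor_space_unique[OF V W
          linear_map_comp[OF tensor_map_linear[OF f g] tensor_map_linear[OF f' g']]
          linear_map_ident[OF vectorspace_tensor_space[OF V W]] _ t])
      (simp add: tensor_map_elem[OF f g] tensor_map_elem[OF f' g'] linear_mapD(3)[OF f]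
        linear_mapD(3)[OF g] assms(5,6))
qed

section \<open>Threefold tensor powers\<close>

locale tensor_cube = vectorspace K V
  for K :: "('k, 'kx) ring_scheme" and V :: "('k, 'v, 'vx) module_scheme"
begin

abbreviation "V2 \<equiv> tensor_space K V V"
abbreviation "V3 \<equiv> tensor_space K V2 V"
abbreviation "V3r \<equiv> tensor_space K V V2"
abbreviation "e2 \<equiv> tensor_elem K V V"
abbreviation "e3 x y z \<equiv> tensor_elem K V2 V (e2 x y) z"
abbreviation "e3r x y z \<equiv> tensor_elem K V V2 x (e2 y z)"

lemma V: "vectorspace K V" by (rule vectorspace_axioms)
lemma V2: "vectorspace K V2" by (rule vectorspace_tensor_space[OF V V])
lemma V3: "vectorspace K V3" by (rule vectorspace_tensor_space[OF V2 V])
lemma V3r: "vectorspace K V3r" by (rule vectorspace_tensor_space[OF V V2])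

lemmas e2_bilinear = tensor_elem_bilinear[OF V V]
lemmas e2_linear = bilinear_mapD[OF e2_bilinear]
lemmas e3_outer_linear = bilinear_mapD[OF tensor_elem_bilinear[OF V2 V]]
lemmas e3r_outer_linear = bilinear_mapD[OF tensor_elem_bilinear[OF V V2]]

lemma e2_closed: "\<lbrakk>x \<in> carrier V; y \<in> carrier V\<rbrakk> \<Longrightarrow> e2 x y \<in> carrier V2"
  by (rule tensor_elem_closed[OF V V])

lemma e3_closed:
  "\<lbrakk>x \<in> carrier V; y \<in> carrier V; z \<in> carrier V\<rbrakk> \<Longrightarrow> e3 x y z \<in> carrier V3"
  by (intro tensor_elem_closed[OF V2 V] e2_closed)

lemma e3r_closed:
  "\<lbrakk>x \<in> carrier V; y \<in> carrier V; z \<in> carrier V\<rbrakk> \<Longrightarrow> e3r x y z \<in> carrier V3r"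
  by (intro tensor_elem_closed[OF V V2] e2_closed)

lemma e3_linear:
  assumes "x \<in> carrier V" and "y \<in> carrier V"
  shows "linear_map K V V3 (\<lambda>v. e3 v x y)"
    and "linear_map K V V3 (\<lambda>v. e3 x v y)"
    and "linear_map K V V3 (\<lambda>v. e3 x y v)"
  using linear_map_comp[OF e2_linear(2)[OF assms(1)] e3_outer_linear(2)[OF assms(2)]]
    linear_map_comp[OF e2_linear(1)[OF assms(1)] e3_outer_linear(2)[OF assms(2)]]
    e3_outer_linear(1)[OF e2_closed[OF assms]]
  by simp_all

lemma e3r_linear:
  assumes "x \<in> carrier V" and "y \<in> carrier V"
  shows "linear_map K V V3r (\<lambda>v. e3r v x y)"
    and "linear_map K V V3r (\<lambda>v. e3r x v y)"
    and "linear_map K V V3r (\<lambda>v. e3r x y v)"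
  using e3r_outer_linear(2)[OF e2_closed[OF assms]]
    linear_map_comp[OF e2_linear(2)[OF assms(2)] e3r_outer_linear(1)[OF assms(1)]]
    linear_map_comp[OF e2_linear(1)[OF assms(2)] e3r_outer_linear(1)[OF assms(1)]]
  by simp_all

text \<open>
  Elementary triples span the threefold power: for a fixed outer factor, the values on elementary
  pairs determine a linear map in the inner tensor.
\<close>

lemma V3_unique:
  assumes h: "linear_map K V3 P h" and h': "linear_map K V3 P h'"
    and elem: "\<And>x y z. \<lbrakk>x \<in> carrier V; y \<in> carrier V; z \<in> carrier V\<rbrakk> \<Longrightarrow>
      h (e3 x y z) = h' (e3 x y z)"
    and t: "t \<in> carrier V3"
  shows "h t = h' t"
proof (rule tensor_space_unique[OF V2 V h h' _ t])
  fix s z assume s: "s \<in> carrier V2" and z: "z \<in> carrier V"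
  note lin = e3_outer_linear(2)[OF z]
  show "h (tensor_elem K V2 V s z) = h' (tensor_elem K V2 V s z)"
    by (rule tensor_space_unique[OF V V linear_map_comp[OF lin h] linear_map_comp[OF lin h'] _ s])
      (rule elem[OF _ _ z])
qed

lemma V3r_unique:
  assumes h: "linear_map K V3r P h" and h': "linear_map K V3r P h'"
    and elem: "\<And>x y z. \<lbrakk>x \<in> carrier V; y \<in> carrier V; z \<in> carrier V\<rbrakk> \<Longrightarrow>
      h (e3r x y z) = h' (e3r x y z)"
    and t: "t \<in> carrier V3r"
  shows "h t = h' t"
proof (rule tensor_space_unique[OF V V2 h h' _ t])
  fix x s assume x: "x \<in> carrier V" and s: "s \<in> carrier V2"
  note lin = e3r_outer_linear(1)[OF x]
  show "h (tensor_elem K V V2 x s) = h' (tensor_elem K V V2 x s)"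
    by (rule tensor_space_unique[OF V V linear_map_comp[OF lin h] linear_map_comp[OF lin h'] _ s])
      (rule elem[OF x])
qed

lemma assoc_bilinear:
  "bilinear_map K V2 V V3r (\<lambda>t z. tensor_lift K V V V3r (\<lambda>x y. e3r x y z) t)"
  by (rule tensor_lift_bilinear[OF V V V V3r]) (blast intro: bilinear_mapI e3r_linear)+

lemma assoc_inner_bilinear:
  "z \<in> carrier V \<Longrightarrow> bilinear_map K V V V3r (\<lambda>x y. e3r x y z)"
  by (blast intro: bilinear_mapI e3r_linear)

lemma assoc_inv_inner_bilinear:
  "x \<in> carrier V \<Longrightarrow> bilinear_map K V V V3 (\<lambda>y z. e3 x y z)"
  by (blast intro: bilinear_mapI e3_linear)

lemma assoc_inv_bilinear:
  "bilinear_map K V V2 V3 (\<lambda>x t. tensor_lift K V V V3 (\<lambda>y z. e3 x y z) t)"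
  by (rule bilinear_map_swap, rule tensor_lift_bilinear[OF V V V V3])
    (blast intro: bilinear_mapI e3_linear)+

lemma tensor_assoc_linear: "linear_map K V3 V3r (tensor_assoc K V)"
  unfolding tensor_assoc_def Let_def
  by (rule tensor_lift_linear[OF V2 V V3r assoc_bilinear])

lemma tensor_assoc_elem:
  "\<lbrakk>x \<in> carrier V; y \<in> carrier V; z \<in> carrier V\<rbrakk> \<Longrightarrow> tensor_assoc K V (e3 x y z) = e3r x y z"
  unfolding tensor_assoc_def Let_def
  by (simp add: tensor_lift_elem[OF V2 V V3r assoc_bilinear] e2_closed
      tensor_lift_elem[OF V V V3r assoc_inner_bilinear])

lemma tensor_assoc_inv_linear: "linear_map K V3r V3 (tensor_assoc_inv K V)"
  unfolding tensor_assoc_inv_def Let_def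
  by (rule tensor_lift_linear[OF V V2 V3 assoc_inv_bilinear])

lemma tensor_assoc_inv_elem:
  "\<lbrakk>x \<in> carrier V; y \<in> carrier V; z \<in> carrier V\<rbrakk> \<Longrightarrow>
    tensor_assoc_inv K V (e3r x y z) = e3 x y z"
  unfolding tensor_assoc_inv_def Let_def
  by (simp add: tensor_lift_elem[OF V V2 V3 assoc_inv_bilinear] e2_closed
      tensor_lift_elem[OF V V V3 assoc_inv_inner_bilinear])

lemma tensor_assoc_inv_assoc:
  "t \<in> carrier V3 \<Longrightarrow> tensor_assoc_inv K V (tensor_assoc K V t) = t"
  by (rule V3_unique[OF linear_map_comp[OF tensor_assoc_linear tensor_assoc_inv_linear]
        linear_map_ident[OF V3]])
    (simp_all add: tensor_assoc_elem tensor_assoc_inv_elem)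

lemma tensor_assoc_assoc_inv:
  "t \<in> carrier V3r \<Longrightarrow> tensor_assoc K V (tensor_assoc_inv K V t) = t"
  by (rule V3r_unique[OF linear_map_comp[OF tensor_assoc_inv_linear tensor_assoc_linear]
        linear_map_ident[OF V3r]])
    (simp_all add: tensor_assoc_elem tensor_assoc_inv_elem)

section \<open>The Hom-Yang-Baxter equation\<close>

context
  fixes \<alpha> :: "'v \<Rightarrow> 'v" and B :: "('v \<times> 'v \<Rightarrow> 'k) set \<Rightarrow> ('v \<times> 'v \<Rightarrow> 'k) set"
  assumes \<alpha>: "linear_map K V V \<alpha>" and B: "linear_map K V2 V2 B"
begin

lemma hom_left_linear: "linear_map K V3 V3 (hom_left K V \<alpha> B)"
  unfolding hom_left_def by (rule tensor_map_linear[OF B \<alpha>])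

lemma hom_left_elem:
  "\<lbrakk>x \<in> carrier V; y \<in> carrier V; z \<in> carrier V\<rbrakk> \<Longrightarrow>
    hom_left K V \<alpha> B (e3 x y z) = tensor_elem K V2 V (B (e2 x y)) (\<alpha> z)"
  unfolding hom_left_def by (intro tensor_map_elem[OF B \<alpha>] e2_closed)

lemma hom_right_linear: "linear_map K V3 V3 (hom_right K V \<alpha> B)"
  unfolding hom_right_def comp_def
  by (intro linear_map_comp[OF tensor_assoc_linear]
      linear_map_comp[OF tensor_map_linear[OF \<alpha> B]] tensor_assoc_inv_linear)

lemma hom_right_elem:
  "\<lbrakk>x \<in> carrier V; y \<in> carrier V; z \<in> carrier V\<rbrakk> \<Longrightarrow>
    hom_right K V \<alpha> B (e3 x y z)
      = tensor_assoc_inv K V (tensor_elem K V V2 (\<alpha> x) (B (e2 y z)))"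
  unfolding hom_right_def
  by (simp add: tensor_assoc_elem tensor_map_elem[OF \<alpha> B] e2_closed)

end

context
  fixes \<alpha> B B'
  assumes \<alpha>: "linear_map K V V \<alpha>" and B: "linear_map K V2 V2 B" and B': "linear_map K V2 V2 B'"
    and invol: "\<And>x. x \<in> carrier V \<Longrightarrow> \<alpha> (\<alpha> x) = x"
    and inv: "\<And>t. t \<in> carrier V2 \<Longrightarrow> B' (B t) = t"
begin

lemma hom_left_inverse: "t \<in> carrier V3 \<Longrightarrow> hom_left K V \<alpha> B' (hom_left K V \<alpha> B t) = t"
  unfolding hom_left_def by (rule tensor_map_inverse[OF B \<alpha> B' \<alpha> inv invol])

lemma hom_right_inverse:
  assumes t: "t \<in> carrier V3"
  shows "hom_right K V \<alpha> B' (hom_right K V \<alpha> B t) = t"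
proof -
  note a = linear_mapD(3)[OF tensor_assoc_linear t]
  show ?thesis
    unfolding hom_right_def
    by (simp add: t a tensor_assoc_assoc_inv tensor_assoc_inv_assoc
        linear_mapD(3)[OF tensor_map_linear[OF \<alpha> B]]
        tensor_map_inverse[OF \<alpha> B \<alpha> B' invol inv])
qed

end

text \<open>
  When the twist is an involution, inverting \<open>B\<close> inverts \<open>B \<otimes> \<alpha>\<close> and \<open>\<alpha> \<otimes> B\<close>, and both
  conditions on a solution equate composites of invertible maps, so that
  inverting both sides gives the same conditions for the inverse.
\<close>

lemma hybe_solution_inverse:
  assumes sol: "hybe_solution K V \<alpha> B" and B': "linear_map K V2 V2 B'"
    and invol: "\<And>x. x \<in> carrier V \<Longrightarrow> \<alpha> (\<alpha> x) = x"
    and B'B: "\<And>t. t \<in> carrier V2 \<Longrightarrow> B' (B t) = t"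
    and BB': "\<And>t. t \<in> carrier V2 \<Longrightarrow> B (B' t) = t"
  shows "hybe_solution K V \<alpha> B'"
proof -
  let ?A = "tensor_map K V V V V \<alpha> \<alpha>"
  let ?l = "hom_left K V \<alpha> B" and ?r = "hom_right K V \<alpha> B"
  let ?l' = "hom_left K V \<alpha> B'" and ?r' = "hom_right K V \<alpha> B'"
  have \<alpha>: "linear_map K V V \<alpha>" and B: "linear_map K V2 V2 B"
    and comm: "\<And>t. t \<in> carrier V2 \<Longrightarrow> ?A (B t) = B (?A t)"
    and braid: "\<And>t. t \<in> carrier V3 \<Longrightarrow> ?r (?l (?r t)) = ?l (?r (?l t))"
    using sol by (simp_all add: hybe_solution_def)
  note closed = linear_mapD(3)[OF tensor_map_linear[OF \<alpha> \<alpha>]] linear_mapD(3)[OF B']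
    linear_mapD(3)[OF hom_left_linear[OF \<alpha> B']] linear_mapD(3)[OF hom_right_linear[OF \<alpha> B']]
    linear_mapD(3)[OF hom_left_linear[OF \<alpha> B]] linear_mapD(3)[OF hom_right_linear[OF \<alpha> B]]
  have "?A (B' t) = B' (?A t)" if t: "t \<in> carrier V2" for t
  proof -
    have "?A (B' t) = B' (B (?A (B' t)))" by (simp add: B'B closed t)
    also have "B (?A (B' t)) = ?A t" by (simp add: comm[symmetric] BB' closed t)
    finally show ?thesis .
  qed
  moreover have "?r' (?l' (?r' t)) = ?l' (?r' (?l' t))" if t: "t \<in> carrier V3" for t
  proof -
    \<comment> \<open>The braid relation at \<open>?s\<close> says \<open>t = l (r (l ?s))\<close>, which \<open>l' r' l'\<close> takes back to \<open>?s\<close>.\<close>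
    let ?s = "?r' (?l' (?r' t))"
    have "?r (?l (?r ?s)) = t"
      by (simp add: hom_left_inverse[OF \<alpha> B' B invol BB']
          hom_right_inverse[OF \<alpha> B' B invol BB'] closed t)
    then have "?l' (?r' (?l' t)) = ?l' (?r' (?l' (?l (?r (?l ?s)))))"
      by (simp add: braid closed t)
    also have "\<dots> = ?s"
      by (simp add: hom_left_inverse[OF \<alpha> B B' invol B'B]
          hom_right_inverse[OF \<alpha> B B' invol B'B] closed t)
    finally show ?thesis by simp
  qed
  ultimately show ?thesis using \<alpha> B' by (simp add: hybe_solution_def)
qed

end


section \<open>The solution attached to a central element of a Hom-Lie algebra\<close>

locale hom_lie_central = hom_lie_algebra K L bracket \<alpha>
  for K :: "('k, 'kx) ring_scheme" and L :: "('k, 'v, 'vx) module_scheme" and bracket \<alpha> +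
  fixes u :: 'v and c :: 'k
  assumes u_center: "u \<in> hom_lie_center L bracket" and twist_u: "\<alpha> u = u"
    and c_closed: "c \<in> carrier K"

sublocale hom_lie_central \<subseteq> tensor_cube K L ..

context hom_lie_central
begin

interpretation V2: vectorspace K V2 by (rule V2)
interpretation V3: vectorspace K V3 by (rule V3)
interpretation V3r: vectorspace K V3r by (rule V3r)

abbreviation "B \<equiv> hom_lie_B K L bracket \<alpha> u c"
abbreviation "B' \<equiv> hom_lie_B_inv K L bracket \<alpha> u c"

lemma u_closed: "u \<in> carrier L"
  using u_center by (simp add: hom_lie_center_def)

lemmas twist_closed = linear_mapD(3)[OF twist_linear]

lemmas bracket_linear = bilinear_mapD[OF bracket_bilinear]

lemma bracket_closed: "\<lbrakk>x \<in> carrier L; y \<in> carrier L\<rbrakk> \<Longrightarrow> bracket x y \<in> carrier L"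
  by (rule linear_mapD(3)[OF bracket_linear(1)])

lemma bracket_u:
  assumes "x \<in> carrier L"
  shows "bracket u x = \<zero>\<^bsub>L\<^esub>" and "bracket x u = \<zero>\<^bsub>L\<^esub>"
proof -
  show ux: "bracket u x = \<zero>\<^bsub>L\<^esub>" using u_center assms by (simp add: hom_lie_center_def)
  show "bracket x u = \<zero>\<^bsub>L\<^esub>" using skew_symmetry[OF assms u_closed] by (simp add: ux)
qed

lemmas closed = u_closed c_closed twist_closed bracket_closed e2_closed e3_closed

text \<open>
  The Hom-Jacobi identity, solved for its first summand by skew symmetry, says that bracketing
  with \<open>\<alpha> x\<close> is a twisted derivation. In this form it matches the three double brackets that the
  braid relation produces.
\<close>

lemma hom_leibniz:
  assumes "x \<in> carrier L" and "y \<in> carrier L" and "z \<in> carrier L"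
  shows "bracket (\<alpha> x) (bracket y z)
    = bracket (bracket x y) (\<alpha> z) \<oplus>\<^bsub>L\<^esub> bracket (\<alpha> y) (bracket x z)"
proof -
  have "bracket (\<alpha> x) (bracket y z)
      = \<ominus>\<^bsub>L\<^esub> (bracket (\<alpha> y) (bracket z x) \<oplus>\<^bsub>L\<^esub> bracket (\<alpha> z) (bracket x y))"
    using hom_jacobi[OF assms] assms
    by (intro M.minus_equality[symmetric]) (simp_all add: closed M.a_ac)
  also have "\<dots> = \<ominus>\<^bsub>L\<^esub> bracket (\<alpha> z) (bracket x y) \<oplus>\<^bsub>L\<^esub> \<ominus>\<^bsub>L\<^esub> bracket (\<alpha> y) (bracket z x)"
    using assms by (simp add: closed M.minus_add M.a_ac)
  also have "\<ominus>\<^bsub>L\<^esub> bracket (\<alpha> z) (bracket x y) = bracket (bracket x y) (\<alpha> z)"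
    using assms by (intro skew_symmetry[symmetric] closed)
  also have "\<ominus>\<^bsub>L\<^esub> bracket (\<alpha> y) (bracket z x) = bracket (\<alpha> y) (bracket x z)"
    using assms by (subst skew_symmetry[of x z])
      (simp_all add: closed linear_mapD(6)[OF bracket_linear(1)])
  finally show ?thesis .
qed

lemma B_form_bilinear:
  "bilinear_map K L L V2 (\<lambda>x y. (c \<odot>\<^bsub>V2\<^esub> e2 (bracket x y) u) \<ominus>\<^bsub>V2\<^esub> e2 (\<alpha> y) (\<alpha> x))"
  by (intro bilinear_mapI linear_map_diff linear_map_smult c_closed
      linear_map_comp[OF _ e2_linear(1)] linear_map_comp[OF _ e2_linear(2)]
      bracket_linear twist_linear closed)

lemma B'_form_bilinear:
  "bilinear_map K L L V2 (\<lambda>x y. (c \<odot>\<^bsub>V2\<^esub> e2 u (bracket x y)) \<ominus>\<^bsub>V2\<^esub> e2 (\<alpha> y) (\<alpha> x))"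
  by (intro bilinear_mapI linear_map_diff linear_map_smult c_closed
      linear_map_comp[OF _ e2_linear(1)] linear_map_comp[OF _ e2_linear(2)]
      bracket_linear twist_linear closed)

lemma B_linear: "linear_map K V2 V2 B"
  unfolding hom_lie_B_def by (rule tensor_lift_linear[OF V V V2 B_form_bilinear])

lemma B'_linear: "linear_map K V2 V2 B'"
  unfolding hom_lie_B_inv_def by (rule tensor_lift_linear[OF V V V2 B'_form_bilinear])

lemma B_elem:
  "\<lbrakk>x \<in> carrier L; y \<in> carrier L\<rbrakk> \<Longrightarrow>
    B (e2 x y) = (c \<odot>\<^bsub>V2\<^esub> e2 (bracket x y) u) \<ominus>\<^bsub>V2\<^esub> e2 (\<alpha> y) (\<alpha> x)"
  unfolding hom_lie_B_def by (rule tensor_lift_elem[OF V V V2 B_form_bilinear])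

lemma B'_elem:
  "\<lbrakk>x \<in> carrier L; y \<in> carrier L\<rbrakk> \<Longrightarrow>
    B' (e2 x y) = (c \<odot>\<^bsub>V2\<^esub> e2 u (bracket x y)) \<ominus>\<^bsub>V2\<^esub> e2 (\<alpha> y) (\<alpha> x)"
  unfolding hom_lie_B_inv_def by (rule tensor_lift_elem[OF V V V2 B'_form_bilinear])

lemma B_commutes_twist:
  assumes "t \<in> carrier V2"
  shows "tensor_map K L L L L \<alpha> \<alpha> (B t) = B (tensor_map K L L L L \<alpha> \<alpha> t)"
proof -
  note A = tensor_map_linear[OF twist_linear twist_linear]
  show ?thesis
    by (rule tensor_space_unique[OF V V linear_map_comp[OF B_linear A]
          linear_map_comp[OF A B_linear] _ assms])
      (simp add: B_elem tensor_map_elem[OF twist_linear twist_linear] closed linear_mapD[OF A]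
        twist_bracket twist_u)
qed

abbreviation "Bl \<equiv> hom_left K L \<alpha> B"
abbreviation "Br \<equiv> hom_right K L \<alpha> B"

lemmas Bl_linear = hom_left_linear[OF twist_linear B_linear]
lemmas Br_linear = hom_right_linear[OF twist_linear B_linear]

lemma Bl_elem:
  assumes "x \<in> carrier L" and "y \<in> carrier L" and "z \<in> carrier L"
  shows "Bl (e3 x y z) = (c \<odot>\<^bsub>V3\<^esub> e3 (bracket x y) u (\<alpha> z)) \<ominus>\<^bsub>V3\<^esub> e3 (\<alpha> y) (\<alpha> x) (\<alpha> z)"
  using assms
  by (simp add: hom_left_elem[OF twist_linear B_linear] B_elem closed
      linear_mapD[OF e3_outer_linear(2)])

lemma Br_elem:
  assumes "x \<in> carrier L" and "y \<in> carrier L" and "z \<in> carrier L"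
  shows "Br (e3 x y z) = (c \<odot>\<^bsub>V3\<^esub> e3 (\<alpha> x) (bracket y z) u) \<ominus>\<^bsub>V3\<^esub> e3 (\<alpha> x) (\<alpha> z) (\<alpha> y)"
  using assms
  by (simp add: hom_right_elem[OF twist_linear B_linear] B_elem closed e3r_closed
      linear_mapD[OF e3r_outer_linear(1)] linear_mapD[OF tensor_assoc_inv_linear]
      tensor_assoc_inv_elem)

lemma e3_zero:
  assumes "x \<in> carrier L" and "y \<in> carrier L"
  shows "e3 \<zero>\<^bsub>L\<^esub> x y = \<zero>\<^bsub>V3\<^esub>" and "e3 x \<zero>\<^bsub>L\<^esub> y = \<zero>\<^bsub>V3\<^esub>" and "e3 x y \<zero>\<^bsub>L\<^esub> = \<zero>\<^bsub>V3\<^esub>"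
  using linear_mapD(8)[OF e3_linear(1)[OF assms]] linear_mapD(8)[OF e3_linear(2)[OF assms]]
    linear_mapD(8)[OF e3_linear(3)[OF assms]]
  by simp_all

text \<open>
  Once brackets with \<open>u\<close> are dropped, both sides at \<open>x \<otimes> y \<otimes> z\<close> equal
  \<open>- c\<^sup>2 \<alpha>[\<alpha> x, [y, z]] \<otimes> u \<otimes> u + c \<alpha>\<^sup>2[y, z] \<otimes> u \<otimes> \<alpha>\<^sup>3 x + c \<alpha>\<^sup>2[x, z] \<otimes> \<alpha>\<^sup>3 y \<otimes> u
  + c \<alpha>\<^sup>3 z \<otimes> \<alpha>\<^sup>2[x, y] \<otimes> u - \<alpha>\<^sup>3 z \<otimes> \<alpha>\<^sup>3 y \<otimes> \<alpha>\<^sup>3 x\<close>.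
\<close>

lemma B_braid:
  assumes t: "t \<in> carrier V3"
  shows "Br (Bl (Br t)) = Bl (Br (Bl t))"
proof (rule V3_unique[OF linear_map_comp[OF linear_map_comp[OF Br_linear Bl_linear] Br_linear]
      linear_map_comp[OF linear_map_comp[OF Bl_linear Br_linear] Bl_linear] _ t])
  fix x y z assume xyz: "x \<in> carrier L" "y \<in> carrier L" "z \<in> carrier L"
  note lin = linear_mapD[OF Bl_linear] linear_mapD[OF Br_linear]
  \<comment> \<open>Moving \<open>\<alpha>\<close> inside brackets turns \<open>\<alpha>[\<alpha> x, [y, z]]\<close> into \<open>[\<alpha>(\<alpha> x), [\<alpha> y, \<alpha> z]]\<close>. Only this
    instance is given to the simplifier, since the right-hand side of the general rule contains
    an instance of its left-hand side.\<close>
  note jac = hom_leibniz[of "\<alpha> x" "\<alpha> y" "\<alpha> z"]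
  show "Br (Bl (Br (e3 x y z))) = Bl (Br (Bl (e3 x y z)))"
    using xyz
    by (simp add: Bl_elem Br_elem closed lin bracket_u e3_zero twist_u twist_bracket jac
        linear_mapD(4)[OF e3_linear(1)] V3.smult_r_distr V3.smult_r_minus V3.M.minus_eq
        V3.M.minus_add V3.M.a_ac)
qed

lemma B_hybe: "hybe_solution K L \<alpha> B"
  by (simp add: hybe_solution_def twist_linear B_linear B_commutes_twist B_braid)

context
  assumes invol: "\<And>x. x \<in> carrier L \<Longrightarrow> \<alpha> (\<alpha> x) = x"
begin

text \<open>
  In both composites the surviving terms in \<open>c\<close> carry the brackets of \<open>(\<alpha> x, \<alpha> y)\<close> and of
  \<open>(\<alpha> y, \<alpha> x)\<close>; orienting the second by skew symmetry makes them cancel.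
\<close>

lemma B'_B:
  assumes "t \<in> carrier V2"
  shows "B' (B t) = t"
proof (rule tensor_space_unique[OF V V linear_map_comp[OF B_linear B'_linear]
        linear_map_ident[OF V2] _ assms])
  fix x y assume xy: "x \<in> carrier L" "y \<in> carrier L"
  note skew = skew_symmetry[of "\<alpha> y" "\<alpha> x"]
  show "B' (B (e2 x y)) = e2 x y"
    using xy
    by (simp add: B_elem B'_elem closed linear_mapD[OF B'_linear] bracket_u twist_u twist_bracket
      skew invol linear_mapD[OF e2_linear(1)] V2.smult_r_minus V2.M.minus_eq V2.M.minus_add
      V2.M.r_neg1 V2.M.r_neg2)
qed

lemma B_B':
  assumes "t \<in> carrier V2"
  shows "B (B' t) = t"
proof (rule tensor_space_unique[OF V V linear_map_comp[OF B'_linear B_linear]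
        linear_map_ident[OF V2] _ assms])
  fix x y assume xy: "x \<in> carrier L" "y \<in> carrier L"
  note skew = skew_symmetry[of "\<alpha> y" "\<alpha> x"]
  show "B (B' (e2 x y)) = e2 x y"
    using xy
    by (simp add: B_elem B'_elem closed linear_mapD[OF B_linear] bracket_u twist_u twist_bracket
      skew invol linear_mapD[OF e2_linear(2)] V2.smult_r_minus V2.M.minus_eq V2.M.minus_add
      V2.M.r_neg1 V2.M.r_neg2)
qed

end

end

theorem corollary4p2:
  fixes K :: "('k, 'kx) ring_scheme" and L :: "('k, 'v, 'vx) module_scheme"
    and bracket :: "'v \<Rightarrow> 'v \<Rightarrow> 'v" and \<alpha> :: "'v \<Rightarrow> 'v" and u :: 'v and c :: 'k
  defines "T \<equiv> tensor_space K L L"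
    and "B \<equiv> hom_lie_B K L bracket \<alpha> u c"
    and "B' \<equiv> hom_lie_B_inv K L bracket \<alpha> u c"
  assumes "hom_lie_algebra K L bracket \<alpha>"
    and "u \<in> hom_lie_center L bracket" and "\<alpha> u = u"
    and "c \<in> carrier K"
  shows "linear_map K T T B \<and>
      (\<forall>x \<in> carrier L. \<forall>y \<in> carrier L.
         B (tensor_elem K L L x y) =
           (c \<odot>\<^bsub>T\<^esub> tensor_elem K L L (bracket x y) u) \<ominus>\<^bsub>T\<^esub> tensor_elem K L L (\<alpha> y) (\<alpha> x)) \<and>
      hybe_solution K L \<alpha> B \<and>
      ((\<forall>x \<in> carrier L. \<alpha> (\<alpha> x) = x) \<longrightarrow>
        linear_map K T T B' \<and>
        (\<forall>x \<in> carrier L. \<forall>y \<in> carrier L.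
           B' (tensor_elem K L L x y) =
             (c \<odot>\<^bsub>T\<^esub> tensor_elem K L L u (bracket x y)) \<ominus>\<^bsub>T\<^esub> tensor_elem K L L (\<alpha> y) (\<alpha> x)) \<and>
        (\<forall>t \<in> carrier T. B' (B t) = t \<and> B (B' t) = t) \<and>
        hybe_solution K L \<alpha> B')"
proof -
  interpret hom_lie_central K L bracket \<alpha> u c
    using assms(4-7) by (intro hom_lie_central.intro hom_lie_central_axioms.intro)
  let ?B = "hom_lie_B K L bracket \<alpha> u c" and ?B' = "hom_lie_B_inv K L bracket \<alpha> u c"
  show ?thesis
    unfolding T_def B_def B'_def
  proof (intro conjI ballI impI)
    assume "\<forall>x \<in> carrier L. \<alpha> (\<alpha> x) = x"
    then have invol: "\<alpha> (\<alpha> x) = x" if "x \<in> carrier L" for x using that by blast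
    show "linear_map K V2 V2 ?B'" by (rule B'_linear)
    show "?B' (e2 x y) = (c \<odot>\<^bsub>V2\<^esub> e2 u (bracket x y)) \<ominus>\<^bsub>V2\<^esub> e2 (\<alpha> y) (\<alpha> x)"
      if "x \<in> carrier L" "y \<in> carrier L" for x y
      using that by (rule B'_elem)
    show "?B' (?B t) = t" and "?B (?B' t) = t" if "t \<in> carrier V2" for t
      using that by (simp_all add: B'_B[OF invol] B_B'[OF invol])
    show "hybe_solution K L \<alpha> ?B'"
      by (rule hybe_solution_inverse[OF B_hybe B'_linear invol B'_B[OF invol] B_B'[OF invol]])
  qed (rule B_linear B_elem B_hybe | assumption)+
qed

end
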